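(* (i) If $C_2^{>++}\ne\emptyset$, then $C_2^{>++}$ is asymptotic to the lines $\mathbb{R}\times\{\lambda_1(n,]T_1^{m>},T_2[)\}$ and $\{\lambda_1(m,]T_1,T_2^{n>}[)\}\times\mathbb{R}$. (ii) If $C_2^{<++}\ne\emptyset$, then $C_2^{<++}$ is asymptotic to the lines $\mathbb{R}\times\{\lambda_1(n,]T_1,T_2^{m>}[)\}$ and $\{\lambda_1(m,]T_1^{n>},T_2[)\}\times\mathbb{R}$. (iii) If $C_2^{>--}\ne\emptyset$, then $C_2^{>--}$ is asymptotic to the lines $\mathbb{R}\times\{\lambda_{-1}(n,]T_1^{m<},T_2[)\}$ and $\{\lambda_{-1}(m,]T_1,T_2^{n<}[)\}\times\mathbb{R}$. (iv) If $C_2^{<--}\ne\emptyset$, then $C_2^{<--}$ is asymptotic to the lines $\mathbb{R}\times\{\lambda_{-1}(n,]T_1,T_2^{m<}[)\}$ and $\{\lambda_{-1}(m,]T_1^{n<},T_2[)\}\times\mathbb{R}$. (v) If $C_2^{>+-}\ne\emptyset$, then $C_2^{>+-}$ is asymptotic to the lines $\mathbb{R}\times\{\lambda_{-1}(n,]T_1^{m>},T_2[)\}$ and $\{\lambda_{1}(m,]T_1,T_2^{n<}[)\}\times\mathbb{R}$. (vi) If $C_2^{<+-}\ne\emptyset$, then $C_2^{<+-}$ is asymptotic to the lines $\mathbb{R}\times\{\lambda_{-1}(n,]T_1,T_2^{m>}[)\}$ and $\{\lambda_{1}(m,]T_1^{n<},T_2[)\}\times\mathbb{R}$. (vii) If $C_2^{>-+}\ne\emptyset$,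 then $C_2^{>-+}$ is asymptotic to the lines $\mathbb{R}\times\{\lambda_{1}(n,]T_1^{m<},T_2[)\}$ and $\{\lambda_{-1}(m,]T_1,T_2^{n>}[)\}\times\mathbb{R}$. (viii) If $C_2^{<-+}\ne\emptyset$, then $C_2^{<-+}$ is asymptotic to the lines $\mathbb{R}\times\{\lambda_{1}(n,]T_1,T_2^{m<}[)\}$ and $\{\lambda_{-1}(m,]T_1^{n>},T_2[)\}\times\mathbb{R}$.
   Context: Let $T_1<T_2$ be reals and let $p,q,m,n\in C[T_1,T_2]$ be real-valued with $p>0$, $q\ge 0$ on $[T_1,T_2]$, $m\not\equiv 0$, $n\not\equiv 0$. Put $Lu:=-(p(t)u')'+q(t)u$ and $u^{\pm}:=\max\{\pm u,0\}$. For $(a,b)\in\mathbb{R}^2$ consider the problem $$(P)\qquad Lu=a\,m(t)u^{+}-b\,n(t)u^{-}\ \text{in } ]T_1,T_2[,\qquad u(T_1)=u(T_2)=0,$$ solutions being functions $u\in C^1[T_1,T_2]$ with $pu'\in C^1[T_1,T_2]$. $C_2^{>}$ (resp. $C_2^{<}$) is the set of $(a,b)\in\mathbb{R}^2$ such that $(P)$ has a solution $u$ with exactly one zero in $]T_1,T_2[$ and $u'(T_1)>0$ (resp. $u'(T_1)<0$). With $\mathbb{R}^{+}=]0,+\infty[$, $\mathbb{R}^{-}=]-\infty,0[$, the additional superscripts $++$, $--$, $+-$, $-+$ denote intersection with $\mathbb{R}^{+}\times\mathbb{R}^{+}$, $\mathbb{R}^{-}\times\mathbb{R}^{-}$, $\mathbb{R}^{+}\times\mathbb{R}^{-}$,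 $\mathbb{R}^{-}\times\mathbb{R}^{+}$ respectively. Each of these eight sets, when nonempty, is, up to reflections $(a,b)\mapsto(\pm a,\pm b)$, the graph of a strictly decreasing $C^1$ function from some $]\nu,+\infty[$ onto some $]\mu,+\infty[$, $\nu,\mu\ge0$. Such a curve is asymptotic to the horizontal line $\mathbb{R}\times\{\beta\}$ if $b\to\beta$ as $|a|\to+\infty$ with $(a,b)$ on the curve, and asymptotic to the vertical line $\{\alpha\}\times\mathbb{R}$ if $a\to\alpha$ as $|b|\to+\infty$ with $(a,b)$ on the curve. Define $T_1^{m>}:=\inf\{t\in]T_1,T_2[:m(t)>0\}$, $T_2^{m>}:=\sup\{t\in]T_1,T_2[:m(t)>0\}$, $T_1^{m<}:=\inf\{t\in]T_1,T_2[:m(t)<0\}$, $T_2^{m<}:=\sup\{t\in]T_1,T_2[:m(t)<0\}$, and similarly $T_1^{n>},T_2^{n>},T_1^{n<},T_2^{n<}$ for $n$ (each being defined only if the corresponding set is nonempty). For $T_1\le t_1<t_2\le T_2$, $\lambda_1(m,]t_1,t_2[)$ (resp. $\lambda_{-1}(m,]t_1,t_2[)$) denotes the smallest positive (resp. largest negative) eigenvalue $\lambda$ of $Lu=\lambda m(t)u$ in $]t_1,t_2[$, $u(t_1)=u(t_2)=0$; it is defined when $m$ takes positive (resp. negative) values on $]t_1,t_2[$. Similarly for $n$. In each item, the nonemptiness hypothesis guarantees that the quantities appearing in it are well defined. *)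

theory Defs
  imports "HOL-Analysis.Analysis"
begin

text \<open>Derivatives on a closed interval are taken within that interval, hence one-sided at the
  endpoints and independent of the values of the function outside the interval.\<close>

definition deriv_on :: "real set \<Rightarrow> (real \<Rightarrow> real) \<Rightarrow> real \<Rightarrow> real" where
  "deriv_on S f t = vector_derivative f (at t within S)"

definition C1_on :: "real set \<Rightarrow> (real \<Rightarrow> real) \<Rightarrow> bool" where
  "C1_on S f \<longleftrightarrow> f differentiable_on S \<and> continuous_on S (deriv_on S f)"

definition admissible :: "(real \<Rightarrow> real) \<Rightarrow> real \<Rightarrow> real \<Rightarrow> (real \<Rightarrow> real) \<Rightarrow> bool" where
  "admissible p t1 t2 u \<longleftrightarrow>
     C1_on {t1..t2} u \<and> C1_on {t1..t2} (\<lambda>t. p t * deriv_on {t1..t2} u t)"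

definition L_op ::
  "(real \<Rightarrow> real) \<Rightarrow> (real \<Rightarrow> real) \<Rightarrow> real \<Rightarrow> real \<Rightarrow> (real \<Rightarrow> real) \<Rightarrow> real \<Rightarrow> real" where
  "L_op p q t1 t2 u t =
     - deriv_on {t1..t2} (\<lambda>s. p s * deriv_on {t1..t2} u s) t + q t * u t"

definition pos_part :: "(real \<Rightarrow> real) \<Rightarrow> real \<Rightarrow> real" where
  "pos_part u t = max (u t) 0"

definition neg_part :: "(real \<Rightarrow> real) \<Rightarrow> real \<Rightarrow> real" where
  "neg_part u t = max (- u t) 0"

definition solves_P ::
  "(real \<Rightarrow> real) \<Rightarrow> (real \<Rightarrow> real) \<Rightarrow> (real \<Rightarrow> real) \<Rightarrow> (real \<Rightarrow> real) \<Rightarrow> real \<Rightarrow> real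
    \<Rightarrow> real \<Rightarrow> real \<Rightarrow> (real \<Rightarrow> real) \<Rightarrow> bool" where
  "solves_P p q m n T1 T2 a b u \<longleftrightarrow>
     admissible p T1 T2 u \<and>
     (\<forall>t\<in>{T1<..<T2}.
        L_op p q T1 T2 u t = a * m t * pos_part u t - b * n t * neg_part u t) \<and>
     u T1 = 0 \<and> u T2 = 0"

definition C2_gt ::
  "(real \<Rightarrow> real) \<Rightarrow> (real \<Rightarrow> real) \<Rightarrow> (real \<Rightarrow> real) \<Rightarrow> (real \<Rightarrow> real) \<Rightarrow> real \<Rightarrow> real
    \<Rightarrow> (real \<times> real) set" where
  "C2_gt p q m n T1 T2 =
     {(a, b). \<exists>u. solves_P p q m n T1 T2 a b u \<and>
        (\<exists>!t. t \<in> {T1<..<T2} \<and> u t = 0) \<and> deriv_on {T1..T2} u T1 > 0}"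

definition C2_lt ::
  "(real \<Rightarrow> real) \<Rightarrow> (real \<Rightarrow> real) \<Rightarrow> (real \<Rightarrow> real) \<Rightarrow> (real \<Rightarrow> real) \<Rightarrow> real \<Rightarrow> real
    \<Rightarrow> (real \<times> real) set" where
  "C2_lt p q m n T1 T2 =
     {(a, b). \<exists>u. solves_P p q m n T1 T2 a b u \<and>
        (\<exists>!t. t \<in> {T1<..<T2} \<and> u t = 0) \<and> deriv_on {T1..T2} u T1 < 0}"

definition eigenvalue ::
  "(real \<Rightarrow> real) \<Rightarrow> (real \<Rightarrow> real) \<Rightarrow> (real \<Rightarrow> real) \<Rightarrow> real \<Rightarrow> real \<Rightarrow> real \<Rightarrow> bool" where
  "eigenvalue p q w t1 t2 l \<longleftrightarrow>
     (\<exists>u. admissible p t1 t2 u \<and>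
        (\<forall>t\<in>{t1<..<t2}. L_op p q t1 t2 u t = l * w t * u t) \<and>
        u t1 = 0 \<and> u t2 = 0 \<and> (\<exists>t\<in>{t1..t2}. u t \<noteq> 0))"

text \<open>\<open>lam_pos\<close> and \<open>lam_neg\<close> are $\lambda_1$ and $\lambda_{-1}$. They are unspecified if no
  smallest positive (largest negative) eigenvalue exists.\<close>

definition lam_pos ::
  "(real \<Rightarrow> real) \<Rightarrow> (real \<Rightarrow> real) \<Rightarrow> (real \<Rightarrow> real) \<Rightarrow> real \<Rightarrow> real \<Rightarrow> real" where
  "lam_pos p q w t1 t2 = (LEAST l. 0 < l \<and> eigenvalue p q w t1 t2 l)"

definition lam_neg ::
  "(real \<Rightarrow> real) \<Rightarrow> (real \<Rightarrow> real) \<Rightarrow> (real \<Rightarrow> real) \<Rightarrow> real \<Rightarrow> real \<Rightarrow> real" where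
  "lam_neg p q w t1 t2 = (GREATEST l. l < 0 \<and> eigenvalue p q w t1 t2 l)"

definition inf_pos :: "(real \<Rightarrow> real) \<Rightarrow> real \<Rightarrow> real \<Rightarrow> real" where
  "inf_pos w T1 T2 = Inf {t \<in> {T1<..<T2}. w t > 0}"

definition sup_pos :: "(real \<Rightarrow> real) \<Rightarrow> real \<Rightarrow> real \<Rightarrow> real" where
  "sup_pos w T1 T2 = Sup {t \<in> {T1<..<T2}. w t > 0}"

definition inf_neg :: "(real \<Rightarrow> real) \<Rightarrow> real \<Rightarrow> real \<Rightarrow> real" where
  "inf_neg w T1 T2 = Inf {t \<in> {T1<..<T2}. w t < 0}"

definition sup_neg :: "(real \<Rightarrow> real) \<Rightarrow> real \<Rightarrow> real \<Rightarrow> real" where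
  "sup_neg w T1 T2 = Sup {t \<in> {T1<..<T2}. w t < 0}"

text \<open>The filters describe $|a| \to +\infty$ (resp. $|b| \to +\infty$) with $(a,b)$ on $C$. Requiring
  them to be proper says that $C$ contains points with arbitrarily large $|a|$ (resp. $|b|$), so that
  the limit is not vacuous.\<close>

definition asymptotic_horizontal :: "(real \<times> real) set \<Rightarrow> real \<Rightarrow> bool" where
  "asymptotic_horizontal C \<beta> \<longleftrightarrow>
     (let F = inf (filtercomap (\<lambda>z. \<bar>fst z\<bar>) at_top) (principal C)
      in F \<noteq> bot \<and> (snd \<longlongrightarrow> \<beta>) F)"

definition asymptotic_vertical :: "(real \<times> real) set \<Rightarrow> real \<Rightarrow> bool" where
  "asymptotic_vertical C \<alpha> \<longleftrightarrow>
     (let F = inf (filtercomap (\<lambda>z. \<bar>snd z\<bar>) at_top) (principal C)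
      in F \<noteq> bot \<and> (fst \<longlongrightarrow> \<alpha>) F)"

end

theory Submission imports Defs begin

text \<open>
A solution of \<open>(P)\<close> with \<open>u'(T1) > 0\<close> and a single interior zero \<open>z\<close> is a positive bump on \<open>[T1, z]\<close>
followed by a negative one on \<open>[z, T2]\<close>. On each bump the equation is linear, so \<open>a\<close> is an eigenvalue
of \<open>L u = \<lambda> m u\<close> on \<open>]T1, z[\<close> with a positive eigenfunction and \<open>b\<close> is one of \<open>L u = \<lambda> n u\<close> on
\<open>]z, T2[\<close>. Conversely two such eigenfunctions can be rescaled so that their fluxes \<open>p u'\<close> agree at \<open>z\<close>,
and then they join to a solution. Hence the curve consists of the points \<open>(\<alpha>(z), \<beta>(z))\<close>, where \<open>\<alpha>(z)\<close>
and \<open>\<beta>(z)\<close> are the principal eigenvalues on the two sides of the junction \<open>z\<close>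
(\<open>C2_gt_eq_junction\<close>).

In the quadrant \<open>a, b > 0\<close> the junction has to stay to the left of \<open>\<sigma> = sup {n > 0}\<close>, because a positive
eigenvalue needs a weight that is positive somewhere. As \<open>z\<close> increases to \<open>\<sigma>\<close> the part of \<open>]z, T2[\<close> where
\<open>n\<close> is positive shrinks to nothing and \<open>\<beta>(z)\<close> blows up, while \<open>\<alpha>(z)\<close> decreases to \<open>\<alpha>(\<sigma>)\<close>. That is the
vertical asymptote (\<open>junction_vertical_asymptote\<close>). Reversing time exchanges the two bumps and gives
the horizontal one. Changing the sign of a weight together with its parameter gives the other
quadrants, and \<open>u \<mapsto> - u\<close> exchanges \<open>(a, m)\<close> with \<open>(b, n)\<close> and reaches the curves with \<open>u'(T1) < 0\<close>.

The analytic core is Picone's inequality (\<open>picone_inequality\<close>): if the equation with parameter \<open>l\<close> has a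
solution that is positive inside an interval, then \<open>l \<integral> w v\<^sup>2 \<le> \<integral> (p v'\<^sup>2 + q v\<^sup>2)\<close> for all \<open>v\<close> vanishing at
the endpoints. Tested with an eigenfunction for \<open>\<mu> > 0\<close>, for which the right-hand side equals
\<open>\<mu> \<integral> w v\<^sup>2 > 0\<close>, it yields \<open>l \<le> \<mu>\<close>. This one comparison (\<open>positive_solution_parameter_le\<close>) shows that a
positive eigenvalue with a positive eigenfunction is the least positive eigenvalue, that it does
not increase when the interval grows, and that it depends continuously from the left on the right
endpoint. Existence of principal eigenvalues is by shooting: \<open>\<lambda>\<^sub>1\<close> is the first parameter for which the solution with
\<open>u(c) = 0\<close>, \<open>(p u')(c) = 1\<close> has a zero in \<open>]c, d]\<close>. It rests on existence, uniqueness and continuous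
dependence for the linear system satisfied by \<open>u\<close> and its flux.
\<close>

section \<open>The first-order system for a function and its flux\<close>

definition regular :: "(real \<Rightarrow> real) \<Rightarrow> (real \<Rightarrow> real) \<Rightarrow> (real \<Rightarrow> real) \<Rightarrow> real \<Rightarrow> real \<Rightarrow> bool" where
  "regular p q w c d \<longleftrightarrow> c < d \<and> continuous_on {c..d} p \<and> continuous_on {c..d} q \<and>
     continuous_on {c..d} w \<and> (\<forall>t\<in>{c..d}. p t > 0 \<and> q t \<ge> 0)"

text \<open>The second-order equation written for the pair of \<open>u\<close> and its flux \<open>y = p u'\<close>. The coefficient \<open>p\<close> is only
continuous, so \<open>u'\<close> itself need not be differentiable, whereas \<open>y\<close> is.\<close>

definition solution ::
  "(real \<Rightarrow> real) \<Rightarrow> (real \<Rightarrow> real) \<Rightarrow> (real \<Rightarrow> real) \<Rightarrow> real \<Rightarrow> real \<Rightarrow> real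
    \<Rightarrow> (real \<Rightarrow> real) \<Rightarrow> (real \<Rightarrow> real) \<Rightarrow> bool" where
  "solution p q w l c d u y \<longleftrightarrow>
     (\<forall>t\<in>{c..d}. (u has_real_derivative y t / p t) (at t within {c..d}) \<and>
        (y has_real_derivative (q t - l * w t) * u t) (at t within {c..d}))"

text \<open>The sign of \<open>l\<close> is left open, so that one notion serves all quadrants. For \<open>l > 0\<close> the value turns out to
be \<open>\<lambda>\<^sub>1\<close> (\<open>lam_pos_eq_principal\<close>).\<close>

definition principal_eigenvalue ::
  "(real \<Rightarrow> real) \<Rightarrow> (real \<Rightarrow> real) \<Rightarrow> (real \<Rightarrow> real) \<Rightarrow> real \<Rightarrow> real \<Rightarrow> real \<Rightarrow> bool" where
  "principal_eigenvalue p q w c d l \<longleftrightarrow>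
     (\<exists>u y. solution p q w l c d u y \<and> u c = 0 \<and> u d = 0 \<and> (\<forall>t\<in>{c<..<d}. u t > 0))"

lemma regular_subinterval:
  assumes "regular p q w c d" "c \<le> c'" "c' < d'" "d' \<le> d"
  shows "regular p q w c' d'"
proof -
  have "{c'..d'} \<subseteq> {c..d}" using assms by auto
  then show ?thesis using assms unfolding regular_def
    by (auto intro: continuous_on_subset)
qed

lemma solution_subinterval:
  assumes "solution p q w l c d u y" "c \<le> c'" "d' \<le> d"
  shows "solution p q w l c' d' u y"
proof -
  have "{c'..d'} \<subseteq> {c..d}" using assms by auto
  then show ?thesis using assms unfolding solution_def
    by (meson DERIV_subset subsetD)
qed

lemma solution_cmult:
  assumes "solution p q w l c d u y"
  shows "solution p q w l c d (\<lambda>t. k * u t) (\<lambda>t. k * y t)"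
  using assms unfolding solution_def
  by (auto intro!: derivative_eq_intros simp: algebra_simps)

lemma solution_continuous:
  assumes "solution p q w l c d u y"
  shows "continuous_on {c..d} u" "continuous_on {c..d} y"
  using assms unfolding solution_def by (auto intro!: DERIV_continuous_on)

lemma has_real_derivative_reflect:
  fixes f :: "real \<Rightarrow> real"
  assumes "(f has_real_derivative D) (at (-t) within {c..d})"
  shows "((\<lambda>s. f (-s)) has_real_derivative -D) (at t within {-d..-c})"
proof -
  have "uminus ` {-d..-c} = {c..d}" by (auto simp: image_def) (metis add.inverse_inverse atLeastAtMost_iff minus_le_iff le_minus_iff)
  then have "((f \<circ> uminus) has_real_derivative D * -1) (at t within {-d..-c})"
    by (intro DERIV_image_chain) (use assms in \<open>auto intro!: derivative_eq_intros\<close>)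
  then show ?thesis by (simp add: o_def)
qed

lemma solution_reflect:
  assumes "solution p q w l c d u y"
  shows "solution (\<lambda>t. p (-t)) (\<lambda>t. q (-t)) (\<lambda>t. w (-t)) l (-d) (-c) (\<lambda>t. u (-t)) (\<lambda>t. - y (-t))"
  unfolding solution_def
proof (intro ballI conjI)
  fix t assume "t \<in> {-d..-c}"
  then have "-t \<in> {c..d}" by auto
  then have *: "(u has_real_derivative y (-t) / p (-t)) (at (-t) within {c..d})"
     "(y has_real_derivative (q (-t) - l * w (-t)) * u (-t)) (at (-t) within {c..d})"
    using assms unfolding solution_def by blast+
  show "((\<lambda>t. u (-t)) has_real_derivative - y (-t) / p (-t)) (at t within {-d..-c})"
    using has_real_derivative_reflect[OF *(1)] by simp
  show "((\<lambda>t. - y (-t)) has_real_derivative (q (-t) - l * w (-t)) * u (-t)) (at t within {-d..-c})"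
    using DERIV_minus[OF has_real_derivative_reflect[OF *(2)]] by (simp add: algebra_simps)
qed

lemma regular_reflect:
  assumes "regular p q w c d"
  shows "regular (\<lambda>t. p (-t)) (\<lambda>t. q (-t)) (\<lambda>t. w (-t)) (-d) (-c)"
proof -
  have "continuous_on {-d..-c} (\<lambda>t. f (-t))" if "continuous_on {c..d} f" for f :: "real \<Rightarrow> real"
    by (rule continuous_on_compose2[OF that]) (auto intro!: continuous_intros)
  then show ?thesis using assms unfolding regular_def by auto
qed

lemma principal_reflect:
  assumes "principal_eigenvalue p q w c d l"
  shows "principal_eigenvalue (\<lambda>t. p (-t)) (\<lambda>t. q (-t)) (\<lambda>t. w (-t)) (-d) (-c) l"
proof -
  obtain u y where "solution p q w l c d u y" "u c = 0" "u d = 0" "\<forall>t\<in>{c<..<d}. u t > 0"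
    using assms unfolding principal_eigenvalue_def by blast
  then show ?thesis unfolding principal_eigenvalue_def
    by (intro exI[of _ "\<lambda>t. u (-t)"] exI[of _ "\<lambda>t. - y (-t)"]) (auto intro: solution_reflect)
qed

lemma principal_neg: "principal_eigenvalue p q (\<lambda>t. - w t) c d (-l) \<longleftrightarrow> principal_eigenvalue p q w c d l"
  unfolding principal_eigenvalue_def solution_def by simp

section \<open>Uniqueness and continuous dependence\<close>

text \<open>The derivative of \<open>u\<^sup>2 + y\<^sup>2\<close> is at most \<open>K (u\<^sup>2 + y\<^sup>2) + e\<^sup>2\<close> by \<open>2 \<bar>u y\<bar> \<le> u\<^sup>2 + y\<^sup>2\<close> and \<open>2 y f \<le> y\<^sup>2 + f\<^sup>2\<close>, so
the function \<open>F\<close> in the proof does not increase. With \<open>e = 0\<close> this is uniqueness. With \<open>f\<close> the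
mismatch of the right-hand sides at two parameters it is continuous dependence on the parameter.\<close>

lemma gronwall_system:
  assumes du: "\<And>t. t \<in> {c..d} \<Longrightarrow> (u has_real_derivative g t * y t) (at t within {c..d})"
    and dy: "\<And>t. t \<in> {c..d} \<Longrightarrow> (y has_real_derivative h t * u t + f t) (at t within {c..d})"
    and K: "\<And>t. t \<in> {c..d} \<Longrightarrow> \<bar>g t\<bar> + \<bar>h t\<bar> + 1 \<le> K"
    and f: "\<And>t. t \<in> {c..d} \<Longrightarrow> \<bar>f t\<bar> \<le> e"
    and t: "t \<in> {c..d}"
  shows "(u t)\<^sup>2 + (y t)\<^sup>2 \<le> exp (K * (t - c)) * ((u c)\<^sup>2 + (y c)\<^sup>2 + e\<^sup>2 * (t - c))"
proof -
  define F where "F = (\<lambda>s. exp (- K * (s - c)) * ((u s)\<^sup>2 + (y s)\<^sup>2) - e\<^sup>2 * (s - c))"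
  define F' where "F' = (\<lambda>s. exp (- K * (s - c)) *
      (2 * u s * (g s * y s) + 2 * y s * (h s * u s + f s) - K * ((u s)\<^sup>2 + (y s)\<^sup>2)) - e\<^sup>2)"
  have der: "(F has_real_derivative F' s) (at s within {c..d})" if "s \<in> {c..d}" for s
    unfolding F_def F'_def
    by (rule derivative_eq_intros du[OF that] dy[OF that] | simp)+ (simp add: algebra_simps power2_eq_square)
  have neg: "F' s \<le> 0" if s: "s \<in> {c..d}" for s
  proof -
    have K0: "K \<ge> 0" using K[OF s] by linarith
    have e0: "exp (- K * (s - c)) \<le> 1" using K0 s by auto
    have uy: "2 * \<bar>u s * y s\<bar> \<le> (u s)\<^sup>2 + (y s)\<^sup>2"
      using sum_squares_bound[of "\<bar>u s\<bar>" "\<bar>y s\<bar>"] by (simp add: abs_mult)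
    have yf: "2 * y s * f s \<le> (y s)\<^sup>2 + (f s)\<^sup>2" by (rule sum_squares_bound)
    have ff: "(f s)\<^sup>2 \<le> e\<^sup>2" using f[OF s] by (metis abs_ge_zero power2_abs power_mono)
    have "2 * u s * (g s * y s) + 2 * y s * (h s * u s) \<le> (\<bar>g s\<bar> + \<bar>h s\<bar>) * (2 * \<bar>u s * y s\<bar>)"
    proof -
      have "2 * u s * (g s * y s) + 2 * y s * (h s * u s) = (g s + h s) * (2 * (u s * y s))"
        by (simp add: algebra_simps)
      also have "\<dots> \<le> \<bar>(g s + h s) * (2 * (u s * y s))\<bar>" by simp
      also have "\<dots> = \<bar>g s + h s\<bar> * (2 * \<bar>u s * y s\<bar>)" by (simp add: abs_mult)
      also have "\<dots> \<le> (\<bar>g s\<bar> + \<bar>h s\<bar>) * (2 * \<bar>u s * y s\<bar>)"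
        by (intro mult_right_mono) auto
      finally show ?thesis .
    qed
    also have "\<dots> \<le> (\<bar>g s\<bar> + \<bar>h s\<bar>) * ((u s)\<^sup>2 + (y s)\<^sup>2)"
      by (intro mult_left_mono uy) auto
    also have "\<dots> \<le> (K - 1) * ((u s)\<^sup>2 + (y s)\<^sup>2)"
      using K[OF s] by (intro mult_right_mono) auto
    finally have "2 * u s * (g s * y s) + 2 * y s * (h s * u s) \<le> (K - 1) * ((u s)\<^sup>2 + (y s)\<^sup>2)" .
    moreover have "(u s)\<^sup>2 \<ge> 0" by simp
    moreover have "2 * y s * (h s * u s + f s) = 2 * y s * (h s * u s) + 2 * y s * f s"
      by (simp add: distrib_left)
    moreover have "(K - 1) * ((u s)\<^sup>2 + (y s)\<^sup>2) = K * ((u s)\<^sup>2 + (y s)\<^sup>2) - ((u s)\<^sup>2 + (y s)\<^sup>2)"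
      by (simp add: left_diff_distrib)
    ultimately have "2 * u s * (g s * y s) + 2 * y s * (h s * u s + f s) - K * ((u s)\<^sup>2 + (y s)\<^sup>2) \<le> e\<^sup>2"
      using yf ff by linarith
    then have "exp (- K * (s - c)) * (2 * u s * (g s * y s) + 2 * y s * (h s * u s + f s) - K * ((u s)\<^sup>2 + (y s)\<^sup>2))
       \<le> exp (- K * (s - c)) * e\<^sup>2" by (intro mult_left_mono) auto
    also have "\<dots> \<le> 1 * e\<^sup>2" by (intro mult_right_mono e0) auto
    finally show ?thesis unfolding F'_def by simp
  qed
  have "F t \<le> F c"
  proof (rule DERIV_nonpos_imp_decreasing_open[of c t F])
    show "c \<le> t" using t by simp
    show "continuous_on {c..t} F"
      by (rule continuous_on_subset[OF DERIV_continuous_on[OF der]]) (use t in auto)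
    fix s assume s: "c < s" "s < t"
    then have "at s within {c..d} = at s" by (intro at_within_interior) (use t in auto)
    then have "(F has_real_derivative F' s) (at s)" using der[of s] s t by auto
    then show "\<exists>y. (F has_real_derivative y) (at s) \<and> y \<le> 0" using neg[of s] s t by auto
  qed
  then have "exp (- K * (t - c)) * ((u t)\<^sup>2 + (y t)\<^sup>2) \<le> (u c)\<^sup>2 + (y c)\<^sup>2 + e\<^sup>2 * (t - c)"
    unfolding F_def by simp
  then have "exp (K * (t - c)) * (exp (- K * (t - c)) * ((u t)\<^sup>2 + (y t)\<^sup>2)) \<le> exp (K * (t - c)) * ((u c)\<^sup>2 + (y c)\<^sup>2 + e\<^sup>2 * (t - c))"
    by (intro mult_left_mono) auto
  then show ?thesis by (simp add: mult.assoc[symmetric] exp_add[symmetric])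
qed

lemma continuous_bounded_interval:
  fixes f :: "real \<Rightarrow> real"
  assumes "continuous_on {c..d} f"
  obtains M where "M > 0" "\<And>t. t \<in> {c..d} \<Longrightarrow> \<bar>f t\<bar> \<le> M"
proof -
  have "bounded (f ` {c..d})" using assms by (intro compact_imp_bounded compact_continuous_image) auto
  then show ?thesis using that unfolding bounded_pos by (auto simp: image_iff)
qed

lemma regular_coefficient_bound:
  assumes "regular p q w c d" "L \<ge> 0"
  obtains M where "M > 0" "\<And>l t. \<bar>l\<bar> \<le> L \<Longrightarrow> t \<in> {c..d} \<Longrightarrow> \<bar>1 / p t\<bar> + \<bar>q t - l * w t\<bar> + 1 \<le> M"
    "\<And>t. t \<in> {c..d} \<Longrightarrow> \<bar>w t\<bar> \<le> M"
proof -
  have p: "continuous_on {c..d} (\<lambda>t. 1 / p t)" using assms unfolding regular_def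
    by (intro continuous_intros) auto
  obtain A where A: "A > 0" "\<And>t. t \<in> {c..d} \<Longrightarrow> \<bar>1 / p t\<bar> \<le> A" using continuous_bounded_interval[OF p] by blast
  obtain B where B: "B > 0" "\<And>t. t \<in> {c..d} \<Longrightarrow> \<bar>q t\<bar> \<le> B"
    using continuous_bounded_interval[of c d q] assms unfolding regular_def by blast
  obtain C where C: "C > 0" "\<And>t. t \<in> {c..d} \<Longrightarrow> \<bar>w t\<bar> \<le> C"
    using continuous_bounded_interval[of c d w] assms unfolding regular_def by blast
  show ?thesis
  proof
    show "A + B + L * C + C + 1 > 0" using A B C assms by (intro add_pos_pos add_pos_nonneg) auto
    fix l t assume t: "t \<in> {c..d}"
    show "\<bar>w t\<bar> \<le> A + B + L * C + C + 1" using C(2)[OF t] A(1) B(1) C(1) assms by (smt (verit) mult_nonneg_nonneg)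
    assume l: "\<bar>l\<bar> \<le> L"
    have "\<bar>l * w t\<bar> \<le> L * C" unfolding abs_mult using C(2)[OF t] l assms by (intro mult_mono) auto
    then show "\<bar>1 / p t\<bar> + \<bar>q t - l * w t\<bar> + 1 \<le> A + B + L * C + C + 1"
      using A(2)[OF t] B(2)[OF t] C by linarith
  qed
qed

text \<open>Used contrapositively: a nontrivial solution that vanishes at an endpoint has nonzero flux there, so
that zeros are simple.\<close>

lemma solution_zero_left:
  assumes "regular p q w c d" "solution p q w l c d u y" "u c = 0" "y c = 0" "t \<in> {c..d}"
  shows "u t = 0"
proof -
  obtain M where M: "\<And>l' t. \<bar>l'\<bar> \<le> \<bar>l\<bar> \<Longrightarrow> t \<in> {c..d} \<Longrightarrow> \<bar>1 / p t\<bar> + \<bar>q t - l' * w t\<bar> + 1 \<le> M"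
    by (rule regular_coefficient_bound[OF assms(1), of "\<bar>l\<bar>"]) (auto intro: that)
  have "(u t)\<^sup>2 + (y t)\<^sup>2 \<le> exp (M * (t - c)) * ((u c)\<^sup>2 + (y c)\<^sup>2 + 0\<^sup>2 * (t - c))"
    by (rule gronwall_system[where g = "\<lambda>t. 1 / p t" and h = "\<lambda>t. q t - l * w t" and f = "\<lambda>t. 0" and d = d])
      (use assms M in \<open>auto simp: solution_def\<close>)
  then show ?thesis using assms by (simp add: sum_power2_le_zero_iff)
qed

lemma solution_zero_right:
  assumes "regular p q w c d" "solution p q w l c d u y" "u d = 0" "y d = 0" "t \<in> {c..d}"
  shows "u t = 0"
  using solution_zero_left[OF regular_reflect[OF assms(1)] solution_reflect[OF assms(2)], of "-t"] assms by auto

section \<open>Existence for the initial value problem\<close>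

lemma picard_integral_bound:
  fixes f :: "real \<Rightarrow> real"
  assumes "continuous_on {c..d} f" "\<And>r. r \<in> {c..d} \<Longrightarrow> \<bar>f r\<bar> \<le> M * ((M * (r - c)) ^ k / fact k)"
    and t: "t \<in> {c..d}"
  shows "\<bar>integral {c..t} f\<bar> \<le> (M * (t - c)) ^ Suc k / fact (Suc k)"
proof -
  have "((\<lambda>r. M * ((M * (r - c)) ^ k / fact k)) has_integral
      (M * (t - c)) ^ Suc k / fact (Suc k) - (M * (c - c)) ^ Suc k / fact (Suc k)) {c..t}"
  proof (rule fundamental_theorem_of_calculus)
    fix r
    have *: "((\<lambda>r. (M * (r - c)) ^ Suc k / fact (Suc k)) has_real_derivative
        (real (Suc k) * (M * (r - c)) ^ k * M) / fact (Suc k)) (at r within {c..t})"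
      by (auto intro!: derivative_eq_intros simp del: fact_Suc power_Suc)
    have "(real (Suc k) * (M * (r - c)) ^ k * M) / fact (Suc k) = M * ((M * (r - c)) ^ k / fact k)"
      by (simp add: field_simps del: of_nat_Suc)
    then show "((\<lambda>r. (M * (r - c)) ^ Suc k / fact (Suc k)) has_vector_derivative M * ((M * (r - c)) ^ k / fact k))
        (at r within {c..t})"
      using * by (simp only: has_real_derivative_iff_has_vector_derivative)
  qed (use t in auto)
  then have *: "((\<lambda>r. M * ((M * (r - c)) ^ k / fact k)) has_integral (M * (t - c)) ^ Suc k / fact (Suc k)) {c..t}"
    by simp
  have "f integrable_on {c..t}"
    by (intro integrable_continuous_real continuous_on_subset[OF assms(1)]) (use t in auto)
  then have "norm (integral {c..t} f) \<le> integral {c..t} (\<lambda>r. M * ((M * (r - c)) ^ k / fact k))"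
    by (rule integral_norm_bound_integral) (use * assms t in \<open>auto simp: has_integral_integrable\<close>)
  then show ?thesis using integral_unique[OF *] by simp
qed

text \<open>One of the two equations of the system for the Picard series. The factorial bounds make the series of
derivatives uniformly convergent, so that it may be differentiated term by term. Both equations have
the same shape and are instances of this lemma.\<close>

lemma picard_series_derivative:
  fixes a b :: "nat \<Rightarrow> real \<Rightarrow> real"
  assumes g: "continuous_on {c..d} g" "\<And>t. t \<in> {c..d} \<Longrightarrow> \<bar>g t\<bar> \<le> M"
    and M: "M \<ge> 0"
    and b: "\<And>k. continuous_on {c..d} (b k)"
      "\<And>k t. t \<in> {c..d} \<Longrightarrow> \<bar>b k t\<bar> \<le> (M * (t - c)) ^ k / fact k"
    and a0: "a 0 = (\<lambda>t. A)"
    and a: "\<And>k t. a (Suc k) t = integral {c..t} (\<lambda>r. g r * b k r)"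
    and t: "t \<in> {c..d}"
  shows "((\<lambda>t. \<Sum>k. a k t) has_real_derivative g t * (\<Sum>k. b k t)) (at t within {c..d})"
proof -
  define a' where "a' = (\<lambda>n t. case n of 0 \<Rightarrow> 0 | Suc k \<Rightarrow> g t * b k t)"
  define B where "B = M * (d - c)"
  have bb: "\<bar>b k t\<bar> \<le> B ^ k / fact k" if "t \<in> {c..d}" for k t
  proof -
    have "(M * (t - c)) ^ k \<le> B ^ k" unfolding B_def
      using that M by (intro power_mono mult_left_mono) auto
    then have "(M * (t - c)) ^ k / fact k \<le> B ^ k / fact k" by (intro divide_right_mono) auto
    then show ?thesis using b(2)[OF that, of k] by linarith
  qed
  have expB: "summable (\<lambda>k. B ^ k / fact k)"
    using summable_exp_generic[of B] by (simp add: field_simps)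
  have sb: "summable (\<lambda>k. b k t)" if "t \<in> {c..d}" for t
    by (rule summable_comparison_test'[OF expB]) (use bb[OF that] in auto)
  have der: "(a n has_real_derivative a' n t) (at t within {c..d})" if "t \<in> {c..d}" for n t
  proof (cases n)
    case 0
    then show ?thesis by (simp add: a0 a'_def)
  next
    case (Suc k)
    have "continuous_on {c..d} (\<lambda>r. g r * b k r)" by (intro continuous_intros g b)
    from integral_has_real_derivative[OF this that] show ?thesis
      unfolding Suc a'_def by (simp add: a[abs_def])
  qed
  have "uniform_limit {c..d} (\<lambda>n t. \<Sum>i<n. a' i t) (\<lambda>t. \<Sum>i. a' i t) sequentially"
  proof (rule Weierstrass_m_test)
    show "norm (a' n t) \<le> (case n of 0 \<Rightarrow> 0 | Suc k \<Rightarrow> M * (B ^ k / fact k))" if "t \<in> {c..d}" for n t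
      using bb[OF that] g(2)[OF that] M
      by (cases n) (auto simp: a'_def abs_mult simp del: times_divide_eq_right intro!: mult_mono)
    have "summable (\<lambda>k. M * (B ^ k / fact k))" by (intro summable_mult expB)
    then show "summable (\<lambda>n. case n of 0 \<Rightarrow> 0 | Suc k \<Rightarrow> M * (B ^ k / fact k))"
      by (subst summable_Suc_iff[symmetric]) simp
  qed
  moreover have "summable (\<lambda>n. a n c)"
    by (subst summable_Suc_iff[symmetric]) (simp add: a)
  moreover have "c \<in> {c..d}" using t by auto
  ultimately have "\<exists>U. \<forall>t\<in>{c..d}. (\<lambda>n. a n t) sums U t \<and>
      (U has_real_derivative (\<Sum>i. a' i t)) (at t within {c..d})"
    by (intro has_field_derivative_series[of "{c..d}" a a' "\<lambda>t. \<Sum>i. a' i t" c] der)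
      (auto simp: convex_real_interval)
  then obtain U where U: "\<And>t. t \<in> {c..d} \<Longrightarrow> (\<lambda>n. a n t) sums U t"
      "\<And>t. t \<in> {c..d} \<Longrightarrow> (U has_real_derivative (\<Sum>i. a' i t)) (at t within {c..d})"
    by blast
  have "(\<Sum>i. a' i t) = g t * (\<Sum>k. b k t)"
  proof -
    have "(\<lambda>k. a' (Suc k) t) sums (g t * (\<Sum>k. b k t))"
      unfolding a'_def using sums_mult[OF summable_sums[OF sb[OF t]]] by simp
    then have "(\<lambda>k. a' k t) sums (g t * (\<Sum>k. b k t) + a' 0 t)" by (rule sums_Suc)
    then show ?thesis by (simp add: a'_def sums_iff)
  qed
  then have "(U has_real_derivative g t * (\<Sum>k. b k t)) (at t within {c..d})" using U(2)[OF t] by simp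
  then show ?thesis
    by (rule has_field_derivative_transform_within[OF _ zero_less_one t])
       (use U(1) in \<open>auto simp: sums_iff\<close>)
qed

text \<open>Picard iteration: the terms of the series arise by integrating the system repeatedly, each term of one
component feeding the next term of the other. The normalisation \<open>y c = 1\<close> makes the solution positive near
\<open>c\<close> locally uniformly in the parameter, as shooting requires.\<close>

lemma initial_value_solution:
  assumes "regular p q w c d"
  obtains u y where "solution p q w l c d u y" "u c = 0" "y c = 1"
proof -
  obtain M where M: "M > 0"
    "\<And>l' t. \<bar>l'\<bar> \<le> \<bar>l\<bar> \<Longrightarrow> t \<in> {c..d} \<Longrightarrow> \<bar>1 / p t\<bar> + \<bar>q t - l' * w t\<bar> + 1 \<le> M"
    by (rule regular_coefficient_bound[OF assms(1), of "\<bar>l\<bar>"]) (auto intro: that)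
  define g where "g = (\<lambda>t. 1 / p t)"
  define h where "h = (\<lambda>t. q t - l * w t)"
  have g: "continuous_on {c..d} g" "\<And>t. t \<in> {c..d} \<Longrightarrow> \<bar>g t\<bar> \<le> M"
    and h: "continuous_on {c..d} h" "\<And>t. t \<in> {c..d} \<Longrightarrow> \<bar>h t\<bar> \<le> M"
  proof -
    show "continuous_on {c..d} g" "continuous_on {c..d} h" using assms unfolding regular_def g_def h_def
      by (force intro!: continuous_intros)+
    show "\<bar>g t\<bar> \<le> M" "\<bar>h t\<bar> \<le> M" if "t \<in> {c..d}" for t
      using M(2)[of l t] that unfolding g_def h_def by linarith+
  qed
  define X where "X = rec_nat (\<lambda>t::real. 0::real, \<lambda>t::real. 1::real)
    (\<lambda>k X. (\<lambda>t. integral {c..t} (\<lambda>r. g r * snd X r), \<lambda>t. integral {c..t} (\<lambda>r. h r * fst X r)))"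
  define a where "a = (\<lambda>k. fst (X k))"
  define b where "b = (\<lambda>k. snd (X k))"
  have a0: "a 0 = (\<lambda>t. 0)" and b0: "b 0 = (\<lambda>t. 1)" unfolding a_def b_def X_def by auto
  have aS: "a (Suc k) t = integral {c..t} (\<lambda>r. g r * b k r)"
    and bS: "b (Suc k) t = integral {c..t} (\<lambda>r. h r * a k r)" for k t
    unfolding a_def b_def X_def by auto
  have *: "continuous_on {c..d} (a k) \<and> continuous_on {c..d} (b k) \<and>
     (\<forall>t\<in>{c..d}. \<bar>a k t\<bar> \<le> (M * (t - c)) ^ k / fact k \<and> \<bar>b k t\<bar> \<le> (M * (t - c)) ^ k / fact k)" for k
  proof (induction k)
    case 0
    then show ?case by (simp add: a0 b0)
  next
    case (Suc k)
    have c1: "continuous_on {c..d} (\<lambda>r. g r * b k r)" "continuous_on {c..d} (\<lambda>r. h r * a k r)"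
      using Suc by (auto intro!: continuous_intros g h)
    have c2: "continuous_on {c..d} (a (Suc k))" "continuous_on {c..d} (b (Suc k))"
      unfolding aS[abs_def] bS[abs_def] using c1
      by (auto intro!: indefinite_integral_continuous_1 integrable_continuous_real)
    have "\<bar>g r * b k r\<bar> \<le> M * ((M * (r - c)) ^ k / fact k)"
      "\<bar>h r * a k r\<bar> \<le> M * ((M * (r - c)) ^ k / fact k)" if "r \<in> {c..d}" for r
      unfolding abs_mult using Suc g(2)[OF that] h(2)[OF that] M(1) that by (intro mult_mono; simp)+
    then have "\<bar>a (Suc k) t\<bar> \<le> (M * (t - c)) ^ Suc k / fact (Suc k)"
       "\<bar>b (Suc k) t\<bar> \<le> (M * (t - c)) ^ Suc k / fact (Suc k)" if "t \<in> {c..d}" for t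
      unfolding aS bS by (intro picard_integral_bound[OF _ _ that] c1; simp)+
    then show ?case using c2 by blast
  qed
  show ?thesis
  proof
    have "((\<lambda>t. \<Sum>k. a k t) has_real_derivative g t * (\<Sum>k. b k t)) (at t within {c..d})"
      "((\<lambda>t. \<Sum>k. b k t) has_real_derivative h t * (\<Sum>k. a k t)) (at t within {c..d})"
      if "t \<in> {c..d}" for t
    proof -
      show "((\<lambda>t. \<Sum>k. a k t) has_real_derivative g t * (\<Sum>k. b k t)) (at t within {c..d})"
        by (rule picard_series_derivative[OF g, where A = 0]) (use M(1) * a0 aS that in auto)
      show "((\<lambda>t. \<Sum>k. b k t) has_real_derivative h t * (\<Sum>k. a k t)) (at t within {c..d})"
        by (rule picard_series_derivative[OF h, where A = 1]) (use M(1) * b0 bS that in auto)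
    qed
    then show "solution p q w l c d (\<lambda>t. \<Sum>k. a k t) (\<lambda>t. \<Sum>k. b k t)"
      unfolding solution_def g_def h_def by auto
    have "(\<lambda>k. a k c) sums (0 + a 0 c)" "(\<lambda>k. b k c) sums (0 + b 0 c)"
      by (intro sums_Suc; simp add: aS bS)+
    then show "(\<Sum>k. a k c) = 0" "(\<Sum>k. b k c) = 1" by (auto simp: sums_iff a0 b0)
  qed
qed

section \<open>Picone's inequality and the Dirichlet energy\<close>

text \<open>Removes the singularity of \<open>v / \<phi>\<close> at an endpoint at which both functions vanish in Picone's identity.\<close>

lemma tendsto_quotient_common_zero:
  fixes f g :: "real \<Rightarrow> real"
  assumes "(f has_real_derivative D) (at x within S)" "(g has_real_derivative E) (at x within S)"
    and "f x = 0" "g x = 0" "E \<noteq> 0"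
  shows "((\<lambda>t. f t / g t) \<longlongrightarrow> D / E) (at x within S)"
proof -
  have "((\<lambda>t. ((f t - f x) / (t - x)) / ((g t - g x) / (t - x))) \<longlongrightarrow> D / E) (at x within S)"
    using assms by (intro tendsto_divide) (auto simp: has_field_derivative_iff)
  moreover have "\<forall>\<^sub>F t in at x within S. ((f t - f x) / (t - x)) / ((g t - g x) / (t - x)) = f t / g t"
    using eventually_neq_at_within[of x x S] by eventually_elim (simp add: assms)
  ultimately show ?thesis by (rule Lim_transform_eventually)
qed

text \<open>Picone's identity: the derivative of \<open>v\<^sup>2 \<eta> / \<phi>\<close>, with \<open>\<eta> = p \<phi>'\<close>, is
\<open>p v'\<^sup>2 + q v\<^sup>2 - l w v\<^sup>2 - p (v' - v \<eta> / (p \<phi>))\<^sup>2\<close>.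
Integrating it, the boundary terms vanish and the last square is dropped. If \<open>\<phi>\<close> vanishes at an endpoint,
\<open>v\<^sup>2 \<eta> / \<phi>\<close> still tends to \<open>0\<close> there, because the zero of \<open>\<phi>\<close> is simple and \<open>v / \<phi>\<close> stays bounded.\<close>

lemma picone_inequality:
  assumes reg: "regular p q w c d" and sol: "solution p q w l c d \<phi> \<eta>"
    and pos: "\<And>t. t \<in> {c<..<d} \<Longrightarrow> \<phi> t > 0"
    and v: "\<And>t. t \<in> {c..d} \<Longrightarrow> (v has_real_derivative v' t) (at t within {c..d})"
    and v': "continuous_on {c..d} v'" and v0: "v c = 0" "v d = 0"
  shows "l * integral {c..d} (\<lambda>t. w t * (v t)\<^sup>2) \<le> integral {c..d} (\<lambda>t. p t * (v' t)\<^sup>2 + q t * (v t)\<^sup>2)"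
proof -
  have cd: "c < d" and cont: "continuous_on {c..d} p" "continuous_on {c..d} q" "continuous_on {c..d} w"
    and p0: "\<And>t. t \<in> {c..d} \<Longrightarrow> p t > 0"
    using reg unfolding regular_def by auto
  have cv: "continuous_on {c..d} v" using v by (rule DERIV_continuous_on)
  have c\<phi>: "continuous_on {c..d} \<phi>" "continuous_on {c..d} \<eta>" using solution_continuous[OF sol] by auto
  define f where "f = (\<lambda>t. v t * \<eta> t * (v t / \<phi> t))"
  define R where "R = (\<lambda>t. p t * (v' t)\<^sup>2 + q t * (v t)\<^sup>2 - l * (w t * (v t)\<^sup>2)
      - p t * (v' t - v t * \<eta> t / (p t * \<phi> t))\<^sup>2)"
  \<comment> \<open>Division by zero gives \<open>0\<close>, so \<open>f t = 0\<close> whenever \<open>v t = 0\<close>, which is the limit needed at an endpoint.\<close>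
  have endpoint: "continuous (at t within {c..d}) f" if t: "t \<in> {c..d}" and vt: "v t = 0"
    and nz: "\<phi> t = 0 \<Longrightarrow> \<eta> t \<noteq> 0" for t
  proof -
    have tends: "(v \<longlongrightarrow> v t) (at t within {c..d})" "(\<phi> \<longlongrightarrow> \<phi> t) (at t within {c..d})"
      "(\<eta> \<longlongrightarrow> \<eta> t) (at t within {c..d})"
      using cv c\<phi> t unfolding continuous_on_def by auto
    obtain L where "((\<lambda>t. v t / \<phi> t) \<longlongrightarrow> L) (at t within {c..d})"
    proof (cases "\<phi> t = 0")
      case True
      have "\<eta> t / p t \<noteq> 0" using nz[OF True] p0[OF t] by simp
      moreover have "(\<phi> has_real_derivative \<eta> t / p t) (at t within {c..d})"
        using sol t unfolding solution_def by blast
      ultimately show ?thesis using that by (metis tendsto_quotient_common_zero v[OF t] vt True)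
    next
      case False
      then show ?thesis using tendsto_divide[OF tends(1,2)] that by blast
    qed
    then have "(f \<longlongrightarrow> v t * \<eta> t * L) (at t within {c..d})" unfolding f_def
      by (intro tendsto_mult tends)
    then show ?thesis unfolding continuous_within by (simp add: vt f_def)
  qed
  have mid: "\<phi> ((c + d) / 2) > 0" using cd by (intro pos) auto
  have der: "(f has_real_derivative R t) (at t)" if t: "t \<in> {c<..<d}" for t
  proof -
    have a: "at t within {c..d} = at t" using t by (intro at_within_interior) auto
    have tt: "t \<in> {c..d}" using t by auto
    have d: "(v has_real_derivative v' t) (at t)" "(\<phi> has_real_derivative \<eta> t / p t) (at t)"
      "(\<eta> has_real_derivative (q t - l * w t) * \<phi> t) (at t)"
      using v[OF tt] sol tt unfolding solution_def a[symmetric] by auto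
    have *: "\<phi> t > 0" "p t > 0" using pos[OF t] p0[OF tt] by auto
    have "(f has_real_derivative ((v' t * \<eta> t + v t * ((q t - l * w t) * \<phi> t)) * (v t / \<phi> t)
       + v t * \<eta> t * ((v' t * \<phi> t - v t * (\<eta> t / p t)) / (\<phi> t * \<phi> t)))) (at t)"
      unfolding f_def using *
      by (auto intro!: derivative_eq_intros d) (simp add: field_simps)
    moreover have "(v' t * \<eta> t + v t * ((q t - l * w t) * \<phi> t)) * (v t / \<phi> t)
       + v t * \<eta> t * ((v' t * \<phi> t - v t * (\<eta> t / p t)) / (\<phi> t * \<phi> t)) = R t"
      unfolding R_def using * by (simp add: field_simps power2_eq_square)
    ultimately show ?thesis by simp
  qed
  have "continuous_on {c..d} f" unfolding continuous_on_eq_continuous_within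
  proof
    fix t assume t: "t \<in> {c..d}"
    consider "t = c" | "t = d" | "t \<in> {c<..<d}" using t by force
    then show "continuous (at t within {c..d}) f"
    proof cases
      case 1
      have "\<eta> c \<noteq> 0" if "\<phi> c = 0"
        using solution_zero_left[OF reg sol that, of "(c + d) / 2"] mid cd by auto
      then show ?thesis using endpoint t v0 1 by blast
    next
      case 2
      have "\<eta> d \<noteq> 0" if "\<phi> d = 0"
        using solution_zero_right[OF reg sol that, of "(c + d) / 2"] mid cd by auto
      then show ?thesis using endpoint t v0 2 by blast
    next
      case 3
      then show ?thesis using DERIV_isCont[OF der] continuous_at_imp_continuous_at_within by blast
    qed
  qed
  then have "(R has_integral f d - f c) {c..d}"
    using cd der by (intro fundamental_theorem_of_calculus_interior)
      (auto simp: has_real_derivative_iff_has_vector_derivative[symmetric])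
  then have RI: "(R has_integral 0) {c..d}" by (simp add: f_def v0)
  have int: "(\<lambda>t. p t * (v' t)\<^sup>2 + q t * (v t)\<^sup>2) integrable_on {c..d}" "(\<lambda>t. w t * (v t)\<^sup>2) integrable_on {c..d}"
    by (intro integrable_continuous_real continuous_intros cont cv v')+
  have "((\<lambda>t. p t * (v' t)\<^sup>2 + q t * (v t)\<^sup>2 - l * (w t * (v t)\<^sup>2)) has_integral
      integral {c..d} (\<lambda>t. p t * (v' t)\<^sup>2 + q t * (v t)\<^sup>2) - l * integral {c..d} (\<lambda>t. w t * (v t)\<^sup>2)) {c..d}"
    by (intro has_integral_diff has_integral_mult_right integrable_integral int)
  from has_integral_le[OF RI this] p0 show ?thesis
    unfolding R_def by (force simp: less_imp_le)
qed

text \<open>The Cauchy--Schwarz estimate \<open>v(t)\<^sup>2 \<le> (t - c) \<integral> v'\<^sup>2\<close>, obtained by integrating \<open>2 k v' - k\<^sup>2 \<le> v'\<^sup>2\<close> with \<open>k\<close>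
the mean slope of \<open>v\<close> on \<open>[c, t]\<close>. It gives both the positivity of the energy and the blow-up of
eigenvalues on short intervals.\<close>

lemma dirichlet_energy_bound:
  assumes reg: "regular p q w c d"
    and v: "\<And>t. t \<in> {c..d} \<Longrightarrow> (v has_real_derivative v' t) (at t within {c..d})"
    and v': "continuous_on {c..d} v'" and v0: "v c = 0"
    and P: "\<And>t. t \<in> {c..d} \<Longrightarrow> P \<le> p t" "P > 0" and t: "t \<in> {c..d}"
  shows "P * (v t)\<^sup>2 \<le> (t - c) * integral {c..d} (\<lambda>t. p t * (v' t)\<^sup>2 + q t * (v t)\<^sup>2)"
proof (cases "t = c")
  case True
  then show ?thesis by (simp add: v0)
next
  case False
  then have tc: "t > c" using t by auto
  have cv: "continuous_on {c..d} v" using v by (rule DERIV_continuous_on)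
  define e where "e = (\<lambda>t. p t * (v' t)\<^sup>2 + q t * (v t)\<^sup>2)"
  have int: "e integrable_on {c..d}" using reg unfolding regular_def e_def
    by (intro integrable_continuous_real continuous_intros cv v') auto
  have e0: "e s \<ge> 0" if "s \<in> {c..d}" for s using reg that unfolding regular_def e_def
    by (simp add: less_imp_le)
  have sub: "{c..t} \<subseteq> {c..d}" using t by auto
  have int': "e integrable_on {c..t}" using int sub by (rule integrable_on_subinterval)
  define k where "k = v t / (t - c)"
  have "((\<lambda>s. 2 * k * v s - k\<^sup>2 * s) has_real_derivative 2 * k * v' s - k\<^sup>2) (at s within {c..t})"
    if "s \<in> {c..t}" for s
    by (rule derivative_eq_intros DERIV_subset[OF v sub] refl | use that t in simp)+
  then have "((\<lambda>s. 2 * k * v' s - k\<^sup>2) has_integral (2 * k * v t - k\<^sup>2 * t) - (2 * k * v c - k\<^sup>2 * c)) {c..t}"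
    using tc by (intro fundamental_theorem_of_calculus)
      (auto simp: has_real_derivative_iff_has_vector_derivative[symmetric])
  moreover have "(2 * k * v t - k\<^sup>2 * t) - (2 * k * v c - k\<^sup>2 * c) = (v t)\<^sup>2 / (t - c)"
  proof -
    have 1: "v t = k * (t - c)" and 2: "(v t)\<^sup>2 / (t - c) = k * v t"
      using tc by (simp_all add: k_def power2_eq_square)
    show ?thesis unfolding 2 v0 by (simp add: 1 algebra_simps power2_eq_square)
  qed
  ultimately have "((\<lambda>s. P * (2 * k * v' s - k\<^sup>2)) has_integral P * ((v t)\<^sup>2 / (t - c))) {c..t}"
    using has_integral_mult_right[of _ "(v t)\<^sup>2 / (t - c)" _ P] by simp
  moreover have "P * (2 * k * v' s - k\<^sup>2) \<le> e s" if "s \<in> {c..t}" for s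
  proof -
    have s: "s \<in> {c..d}" using that t by auto
    have "2 * k * v' s - k\<^sup>2 \<le> (v' s)\<^sup>2" using zero_le_power2[of "v' s - k"] by (simp add: power2_diff algebra_simps)
    then have "P * (2 * k * v' s - k\<^sup>2) \<le> P * (v' s)\<^sup>2" using P by (intro mult_left_mono) auto
    also have "\<dots> \<le> p s * (v' s)\<^sup>2" using P s by (intro mult_right_mono) auto
    also have "\<dots> \<le> e s" using reg s unfolding e_def regular_def by auto
    finally show ?thesis .
  qed
  ultimately have "P * ((v t)\<^sup>2 / (t - c)) \<le> integral {c..t} e"
    by (rule has_integral_le[OF _ integrable_integral[OF int']])
  also have "\<dots> \<le> integral {c..d} e" by (rule integral_subset_le[OF sub int' int]) (use e0 in auto)
  finally show ?thesis using tc unfolding e_def by (simp add: field_simps)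
qed

lemma regular_lower_bound:
  assumes "regular p q w c d"
  obtains P where "P > 0" "\<And>t. t \<in> {c..d} \<Longrightarrow> P \<le> p t"
proof -
  have "\<exists>x\<in>{c..d}. \<forall>y\<in>{c..d}. p x \<le> p y"
    using assms unfolding regular_def by (intro continuous_attains_inf) auto
  then show ?thesis using that assms unfolding regular_def by blast
qed

definition energy where
  "energy p q c d u y = integral {c..d} (\<lambda>t. p t * (y t / p t)\<^sup>2 + q t * (u t)\<^sup>2)"

lemma solution_continuous_derivative:
  assumes "regular p q w c d" "solution p q w l c d u y"
  shows "continuous_on {c..d} (\<lambda>t. y t / p t)"
  using assms solution_continuous[OF assms(2)] unfolding regular_def
  by (intro continuous_intros) auto

lemma energy_bound:
  assumes "regular p q w c d" "solution p q w l c d u y" "u c = 0"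
    "\<And>t. t \<in> {c..d} \<Longrightarrow> P \<le> p t" "P > 0" "t \<in> {c..d}"
  shows "P * (u t)\<^sup>2 \<le> (t - c) * energy p q c d u y"
  unfolding energy_def
  by (rule dirichlet_energy_bound[where v' = "\<lambda>t. y t / p t"])
    (use assms solution_continuous_derivative[OF assms(1,2)] in \<open>auto simp: solution_def\<close>)

lemma energy_pos:
  assumes "regular p q w c d" "solution p q w l c d u y" "u c = 0" "t \<in> {c..d}" "u t \<noteq> 0"
  shows "energy p q c d u y > 0"
proof -
  obtain P where P: "P > 0" "\<And>t. t \<in> {c..d} \<Longrightarrow> P \<le> p t" using regular_lower_bound[OF assms(1)] by blast
  have "0 < P * (u t)\<^sup>2" using P assms by simp
  also have "\<dots> \<le> (t - c) * energy p q c d u y" by (rule energy_bound[OF assms(1-3) P(2,1) assms(4)])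
  finally show ?thesis using assms(4) by (auto simp: zero_less_mult_iff)
qed

text \<open>Multiply the equation by \<open>u\<close> and integrate by parts.\<close>

lemma energy_eq:
  assumes reg: "regular p q w c d" and sol: "solution p q w l c d u y" and u0: "u c = 0" "u d = 0"
  shows "energy p q c d u y = l * integral {c..d} (\<lambda>t. w t * (u t)\<^sup>2)"
proof -
  have cont: "continuous_on {c..d} p" "continuous_on {c..d} q" "continuous_on {c..d} w" and cd: "c < d"
    using reg unfolding regular_def by auto
  note cu = solution_continuous[OF sol] and cy = solution_continuous_derivative[OF reg sol]
  have int: "(\<lambda>t. p t * (y t / p t)\<^sup>2 + q t * (u t)\<^sup>2) integrable_on {c..d}" "(\<lambda>t. w t * (u t)\<^sup>2) integrable_on {c..d}"
    by (intro integrable_continuous_real continuous_intros cont cu cy)+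
  have 1: "((\<lambda>t. p t * (y t / p t)\<^sup>2 + q t * (u t)\<^sup>2 - l * (w t * (u t)\<^sup>2)) has_integral
      energy p q c d u y - l * integral {c..d} (\<lambda>t. w t * (u t)\<^sup>2)) {c..d}"
    unfolding energy_def by (intro has_integral_diff has_integral_mult_right integrable_integral int)
  have der: "((\<lambda>t. u t * y t) has_real_derivative p t * (y t / p t)\<^sup>2 + q t * (u t)\<^sup>2 - l * (w t * (u t)\<^sup>2))
      (at t within {c..d})" if t: "t \<in> {c..d}" for t
  proof -
    have "(u has_real_derivative y t / p t) (at t within {c..d})"
       "(y has_real_derivative (q t - l * w t) * u t) (at t within {c..d})" "p t > 0"
      using sol reg t unfolding solution_def regular_def by auto
    from DERIV_mult[OF this(1,2)] this(3) show ?thesis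
      by (simp add: field_simps power2_eq_square)
  qed
  have "((\<lambda>t. p t * (y t / p t)\<^sup>2 + q t * (u t)\<^sup>2 - l * (w t * (u t)\<^sup>2)) has_integral u d * y d - u c * y c) {c..d}"
    using cd der by (intro fundamental_theorem_of_calculus)
      (auto simp: has_real_derivative_iff_has_vector_derivative[symmetric])
  from has_integral_unique[OF 1 this] show ?thesis by (simp add: u0)
qed

text \<open>The comparison behind all monotonicity statements. For \<open>v\<close> the energy equals \<open>\<mu> \<integral> w v\<^sup>2\<close> and is positive,
so \<open>\<integral> w v\<^sup>2 > 0\<close> and Picone's inequality can be divided by it. The weight \<open>w\<close> may change sign, and then
Sturm's Wronskian argument would not apply.\<close>

lemma positive_solution_parameter_le:
  assumes reg: "regular p q w c d" and sol: "solution p q w l c d \<phi> \<eta>"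
    and pos: "\<And>t. t \<in> {c<..<d} \<Longrightarrow> \<phi> t > 0"
    and v: "solution p q w \<mu> c d v y" "v c = 0" "v d = 0" "t \<in> {c..d}" "v t \<noteq> 0" and \<mu>: "\<mu> > 0"
  shows "l \<le> \<mu>"
proof -
  have E: "energy p q c d v y > 0" using energy_pos[OF reg v(1,2,4,5)] .
  have W: "energy p q c d v y = \<mu> * integral {c..d} (\<lambda>t. w t * (v t)\<^sup>2)" using energy_eq[OF reg v(1-3)] .
  have "l * integral {c..d} (\<lambda>t. w t * (v t)\<^sup>2) \<le> energy p q c d v y" unfolding energy_def
    by (rule picone_inequality[where v' = "\<lambda>t. y t / p t", OF reg sol pos])
      (use v solution_continuous_derivative[OF reg v(1)] in \<open>auto simp: solution_def\<close>)
  then show ?thesis using E \<mu> unfolding W by (simp add: zero_less_mult_iff)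
qed

lemma zero_not_eigenvalue:
  assumes "regular p q w c d" "solution p q w 0 c d v y" "v c = 0" "v d = 0" "t \<in> {c..d}"
  shows "v t = 0"
  using energy_pos[OF assms(1-3,5)] energy_eq[OF assms(1-4)] by force

lemma principal_antimono:
  assumes "regular p q w c d" "principal_eigenvalue p q w c d l" "c \<le> c'" "c' < d'" "d' \<le> d"
    and "principal_eigenvalue p q w c' d' \<mu>" "\<mu> > 0"
  shows "l \<le> \<mu>"
proof -
  obtain u y where u: "solution p q w l c d u y" "u c = 0" "u d = 0" "\<forall>t\<in>{c<..<d}. u t > 0"
    using assms(2) unfolding principal_eigenvalue_def by blast
  obtain v z where v: "solution p q w \<mu> c' d' v z" "v c' = 0" "v d' = 0" "\<forall>t\<in>{c'<..<d'}. v t > 0"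
    using assms(6) unfolding principal_eigenvalue_def by blast
  have "(c' + d') / 2 \<in> {c'<..<d'}" using assms by auto
  then have mid: "(c' + d') / 2 \<in> {c'..d'}" "v ((c' + d') / 2) \<noteq> 0" using v(4) by fastforce+
  show ?thesis
    by (rule positive_solution_parameter_le[OF regular_subinterval[OF assms(1,3-5)]
       solution_subinterval[OF u(1) assms(3,5)] _ v(1-3) mid assms(7)])
      (use u assms in auto)
qed

text \<open>Otherwise \<open>l \<integral> w u\<^sup>2 \<le> 0\<close>, although this number is the energy of \<open>u\<close>.\<close>

lemma principal_pos_weight:
  assumes reg: "regular p q w c d" and "principal_eigenvalue p q w c d l" "l > 0"
  shows "\<exists>t\<in>{c<..<d}. w t > 0"
proof (rule ccontr)
  assume n: "\<not> ?thesis"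
  obtain u y where u: "solution p q w l c d u y" "u c = 0" "u d = 0" "\<forall>t\<in>{c<..<d}. u t > 0"
    using assms(2) unfolding principal_eigenvalue_def by blast
  have cd: "c < d" using reg unfolding regular_def by auto
  have "(c + d) / 2 \<in> {c<..<d}" using cd by auto
  then have "(c + d) / 2 \<in> {c..d}" "u ((c + d) / 2) \<noteq> 0" using u(4) by fastforce+
  then have "energy p q c d u y > 0" by (rule energy_pos[OF reg u(1,2)])
  moreover have "integral {c..d} (\<lambda>t. w t * (u t)\<^sup>2) \<le> integral {c..d} (\<lambda>t. 0)"
  proof (rule integral_le)
    show "(\<lambda>t. w t * (u t)\<^sup>2) integrable_on {c..d}" using reg solution_continuous[OF u(1)] unfolding regular_def
      by (intro integrable_continuous_real continuous_intros) auto
    show "w t * (u t)\<^sup>2 \<le> 0" if t: "t \<in> {c..d}" for t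
    proof (cases "t \<in> {c<..<d}")
      case True
      then have "w t \<le> 0" using n by force
      then show ?thesis by (simp add: mult_nonpos_nonneg)
    next
      case False
      then have "t = c \<or> t = d" using t by auto
      then show ?thesis using u by auto
    qed
  qed auto
  ultimately show False using energy_eq[OF reg u(1-3)] \<open>l > 0\<close> by (auto simp: zero_less_mult_iff)
qed

section \<open>Shooting and the existence of principal eigenvalues\<close>

text \<open>The difference of two shooting solutions solves the system with an inhomogeneity of order \<open>\<bar>l' - l\<bar>\<close>.\<close>

lemma shooting_continuous:
  assumes reg: "regular p q w c d"
    and sol: "\<And>l. solution p q w l c d (U l) (Y l)" and init: "\<And>l. U l c = 0" "\<And>l. Y l c = 1"
    and e: "e > 0"
  shows "\<exists>r>0. \<forall>l'. \<bar>l' - l\<bar> < r \<longrightarrow> (\<forall>t\<in>{c..d}. \<bar>U l' t - U l t\<bar> < e \<and> \<bar>Y l' t - Y l t\<bar> < e)"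
proof -
  obtain M where M: "M > 0"
    "\<And>l' t. \<bar>l'\<bar> \<le> \<bar>l\<bar> + 1 \<Longrightarrow> t \<in> {c..d} \<Longrightarrow> \<bar>1 / p t\<bar> + \<bar>q t - l' * w t\<bar> + 1 \<le> M"
    "\<And>t. t \<in> {c..d} \<Longrightarrow> \<bar>w t\<bar> \<le> M"
    by (rule regular_coefficient_bound[OF reg, of "\<bar>l\<bar> + 1"]) (auto intro: that)
  obtain B where B: "B > 0" "\<And>t. t \<in> {c..d} \<Longrightarrow> \<bar>U l t\<bar> \<le> B"
    using continuous_bounded_interval[OF solution_continuous(1)[OF sol]] by blast
  have cd: "c < d" using reg unfolding regular_def by auto
  define G where "G = exp (M * (d - c)) * (d - c)"
  define A where "A = sqrt G * (M * B)"
  have G: "G > 0" unfolding G_def using cd by simp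
  have A: "A > 0" unfolding A_def using G M B by simp
  have bound: "\<bar>U l' t - U l t\<bar> \<le> A * \<bar>l' - l\<bar>" "\<bar>Y l' t - Y l t\<bar> \<le> A * \<bar>l' - l\<bar>"
    if l': "\<bar>l' - l\<bar> < 1" and t: "t \<in> {c..d}" for l' t
  proof -
    define \<delta> where "\<delta> = \<bar>l' - l\<bar> * (M * B)"
    have l'': "\<bar>l'\<bar> \<le> \<bar>l\<bar> + 1" using l' by linarith
    have "(U l' t - U l t)\<^sup>2 + (Y l' t - Y l t)\<^sup>2
      \<le> exp (M * (t - c)) * ((U l' c - U l c)\<^sup>2 + (Y l' c - Y l c)\<^sup>2 + \<delta>\<^sup>2 * (t - c))"
    proof (rule gronwall_system[where g = "\<lambda>t. 1 / p t" and h = "\<lambda>t. q t - l' * w t"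
          and f = "\<lambda>t. (l - l') * (w t * U l t)" and d = d])
      fix s assume s: "s \<in> {c..d}"
      have d: "(U k has_real_derivative Y k s / p s) (at s within {c..d})"
        "(Y k has_real_derivative (q s - k * w s) * U k s) (at s within {c..d})" for k
        using sol[of k] s unfolding solution_def by auto
      show "((\<lambda>s. U l' s - U l s) has_real_derivative 1 / p s * (Y l' s - Y l s)) (at s within {c..d})"
        using DERIV_diff[OF d(1)[of l'] d(1)[of l]] by (simp add: diff_divide_distrib)
      show "((\<lambda>s. Y l' s - Y l s) has_real_derivative (q s - l' * w s) * (U l' s - U l s) + (l - l') * (w s * U l s))
          (at s within {c..d})"
        using DERIV_diff[OF d(2)[of l'] d(2)[of l]] by (simp add: algebra_simps)
      show "\<bar>1 / p s\<bar> + \<bar>q s - l' * w s\<bar> + 1 \<le> M" by (rule M(2)[OF l'' s])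
      have "\<bar>w s * U l s\<bar> \<le> M * B" unfolding abs_mult using M(3)[OF s] B(2)[OF s] M(1) by (intro mult_mono) auto
      then show "\<bar>(l - l') * (w s * U l s)\<bar> \<le> \<delta>" unfolding \<delta>_def abs_mult[of "l - l'"]
        by (subst abs_minus_commute) (intro mult_left_mono, auto)
    qed (rule t)
    also have "\<dots> = exp (M * (t - c)) * (t - c) * \<delta>\<^sup>2" by (simp add: init)
    also have "\<dots> \<le> G * \<delta>\<^sup>2" unfolding G_def using t M(1)
      by (intro mult_right_mono mult_mono) auto
    also have "\<dots> = (A * \<bar>l' - l\<bar>)\<^sup>2" unfolding A_def \<delta>_def using G by (simp add: power_mult_distrib)
    finally have *: "(U l' t - U l t)\<^sup>2 + (Y l' t - Y l t)\<^sup>2 \<le> (A * \<bar>l' - l\<bar>)\<^sup>2" .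
    have "(U l' t - U l t)\<^sup>2 \<le> (A * \<bar>l' - l\<bar>)\<^sup>2" "(Y l' t - Y l t)\<^sup>2 \<le> (A * \<bar>l' - l\<bar>)\<^sup>2"
      by (rule order_trans[OF _ *], simp)+
    then have "\<bar>U l' t - U l t\<bar> \<le> \<bar>A * \<bar>l' - l\<bar>\<bar>" "\<bar>Y l' t - Y l t\<bar> \<le> \<bar>A * \<bar>l' - l\<bar>\<bar>"
      by (simp_all only: abs_le_square_iff)
    then show "\<bar>U l' t - U l t\<bar> \<le> A * \<bar>l' - l\<bar>" "\<bar>Y l' t - Y l t\<bar> \<le> A * \<bar>l' - l\<bar>"
      using A by (simp_all add: abs_mult)
  qed
  show ?thesis
  proof (intro exI[of _ "min 1 (e / A)"] conjI allI impI)
    show "min 1 (e / A) > 0" using e A by simp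
    fix l' assume l': "\<bar>l' - l\<bar> < min 1 (e / A)"
    then have "A * \<bar>l' - l\<bar> < e" using A by (simp add: field_simps)
    then show "\<forall>t\<in>{c..d}. \<bar>U l' t - U l t\<bar> < e \<and> \<bar>Y l' t - Y l t\<bar> < e" using bound l' by fastforce
  qed
qed

lemma flux_pos_imp_pos:
  assumes "regular p q w c d" "solution p q w l c d u y" "u c = 0" "e \<le> d"
    and "\<And>t. t \<in> {c..e} \<Longrightarrow> y t > 0" "t \<in> {c<..e}"
  shows "u t > 0"
proof -
  have "u c < u t"
  proof (rule DERIV_pos_imp_increasing_open[of c t u])
    fix x assume x: "c < x" "x < t"
    then have "at x within {c..d} = at x" by (intro at_within_interior) (use assms in auto)
    then have "(u has_real_derivative y x / p x) (at x)"
    proof -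
      have "x \<in> {c..d}" using assms x by auto
      then show ?thesis using assms(2) \<open>at x within {c..d} = at x\<close> unfolding solution_def by metis
    qed
    moreover have "y x / p x > 0" using assms x unfolding regular_def by auto
    ultimately show "\<exists>y. (u has_real_derivative y) (at x) \<and> y > 0" by blast
  next
    show "continuous_on {c..t} u"
      by (rule continuous_on_subset[OF solution_continuous(1)[OF assms(2)]]) (use assms in auto)
  qed (use assms in auto)
  then show ?thesis using assms by simp
qed

lemma flux_pos_near_left:
  assumes "regular p q w c d" "solution p q w l c d u y" "k < y c"
  obtains e where "e \<in> {c<..d}" "\<And>t. t \<in> {c..e} \<Longrightarrow> k < y t"
proof -
  have cd: "c < d" using assms unfolding regular_def by auto
  have "continuous_on {c..d} y" using solution_continuous[OF assms(2)] by auto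
  then obtain r where r: "r > 0" "\<And>t. t \<in> {c..d} \<Longrightarrow> dist t c < r \<Longrightarrow> dist (y t) (y c) < y c - k"
    using assms(3) cd unfolding continuous_on_iff by (metis atLeastAtMost_iff diff_gt_0_iff_gt less_imp_le order_refl)
  show ?thesis
  proof
    show "c + min (r / 2) (d - c) \<in> {c<..d}" using r cd by auto
    fix t assume "t \<in> {c..c + min (r / 2) (d - c)}"
    then have "t \<in> {c..d}" "dist t c < r" using r by (auto simp: dist_real_def)
    from r(2)[OF this] show "k < y t" by (simp add: dist_real_def)
  qed
qed

text \<open>Near \<open>c\<close> the flux is positive and \<open>u\<close> increases from \<open>0\<close>, so the zeros of \<open>u\<close> in \<open>]c, d]\<close> keep away from
\<open>c\<close> and there is a first one.\<close>

lemma solution_first_zero: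
  assumes reg: "regular p q w c d" and sol: "solution p q w l c d u y" and u0: "u c = 0" "y c > 0"
    and t: "t \<in> {c<..d}" "u t \<le> 0"
  obtains z where "z \<in> {c<..t}" "u z = 0" "\<And>s. s \<in> {c<..<z} \<Longrightarrow> u s > 0"
proof -
  obtain e where e: "e \<in> {c<..d}" "\<And>t. t \<in> {c..e} \<Longrightarrow> y t > 0" using flux_pos_near_left[OF reg sol u0(2)] by auto
  have pe: "u s > 0" if "s \<in> {c<..e}" for s
    by (rule flux_pos_imp_pos[OF reg sol u0(1) _ e(2) that]) (use e in auto)
  have et: "e < t" using pe[of t] t by force
  have cu: "continuous_on {c..d} u" using solution_continuous[OF sol] by auto
  have zero: "\<exists>x\<in>{e..s}. u x = 0" if "s \<in> {e..d}" "u s \<le> 0" for s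
  proof -
    have "continuous_on {e..s} u" by (rule continuous_on_subset[OF cu]) (use that e in auto)
    moreover have "u e > 0" using pe[of e] e by simp
    ultimately have "\<exists>x\<ge>e. x \<le> s \<and> u x = 0" using that by (intro IVT2') auto
    then show ?thesis by auto
  qed
  define Z where "Z = {s \<in> {e..t}. u s = 0}"
  have "closed Z" unfolding Z_def using t et e
    by (intro continuous_closed_preimage_constant continuous_on_subset[OF cu]) auto
  moreover have "bounded Z" unfolding Z_def by (rule bounded_subset[of "{e..t}"]) auto
  ultimately have "compact Z" by (simp add: compact_eq_bounded_closed)
  moreover have "Z \<noteq> {}" using zero[of t] t et unfolding Z_def by auto
  ultimately have "\<exists>z\<in>Z. \<forall>s\<in>Z. z \<le> s" by (rule compact_attains_inf)
  then obtain z where z: "z \<in> Z" "\<And>s. s \<in> Z \<Longrightarrow> z \<le> s" by blast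
  show ?thesis
  proof
    show "z \<in> {c<..t}" "u z = 0" using z e unfolding Z_def by auto
    fix s assume s: "s \<in> {c<..<z}"
    show "u s > 0"
    proof (rule ccontr)
      assume n: "\<not> u s > 0"
      then have "s > e" using pe[of s] s by force
      then obtain x where "x \<in> {e..s}" "u x = 0" using zero[of s] n s z t unfolding Z_def by auto
      then have "x \<in> Z" using s z unfolding Z_def by auto
      then show False using z(2) \<open>x \<in> {e..s}\<close> s by force
    qed
  qed
qed

text \<open>Uniform closeness of the functions alone does not suffice, since \<open>U l\<close> vanishes at \<open>c\<close>. Near \<open>c\<close>
the closeness of the fluxes is used, and further away the positive minimum of \<open>U l\<close>.\<close>

lemma shooting_pos_open:
  assumes reg: "regular p q w c d"
    and sol: "\<And>l. solution p q w l c d (U l) (Y l)" and init: "\<And>l. U l c = 0" "\<And>l. Y l c = 1"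
    and pos: "\<And>t. t \<in> {c<..d} \<Longrightarrow> U l t > 0"
  shows "\<exists>r>0. \<forall>l'. \<bar>l' - l\<bar> < r \<longrightarrow> (\<forall>t\<in>{c<..d}. U l' t > 0)"
proof -
  obtain e where e: "e \<in> {c<..d}" "\<And>t. t \<in> {c..e} \<Longrightarrow> 1 / 2 < Y l t"
    using flux_pos_near_left[OF reg sol, of "1 / 2" l] init by auto
  have "\<exists>x\<in>{e..d}. \<forall>t\<in>{e..d}. U l x \<le> U l t"
    by (intro continuous_attains_inf continuous_on_subset[OF solution_continuous(1)[OF sol[of l]]]) (use e in auto)
  then obtain x where x: "x \<in> {e..d}" "\<And>t. t \<in> {e..d} \<Longrightarrow> U l x \<le> U l t" by auto
  have "U l x > 0" using pos x e by auto
  then obtain r where r: "r > 0" "\<And>l' t. \<bar>l' - l\<bar> < r \<Longrightarrow> t \<in> {c..d} \<Longrightarrow>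
      \<bar>U l' t - U l t\<bar> < min (1 / 2) (U l x) \<and> \<bar>Y l' t - Y l t\<bar> < min (1 / 2) (U l x)"
    using shooting_continuous[OF reg sol init, of "min (1 / 2) (U l x)" l] by auto
  show ?thesis
  proof (intro exI[of _ r] conjI allI impI ballI r(1))
    fix l' t assume l': "\<bar>l' - l\<bar> < r" and t: "t \<in> {c<..d}"
    show "U l' t > 0"
    proof (cases "t \<le> e")
      case True
      have "Y l' s > 0" if "s \<in> {c..e}" for s
      proof -
        have "\<bar>Y l' s - Y l s\<bar> < 1 / 2" using r(2)[OF l', of s] that e by auto
        then show ?thesis using e(2)[OF that] by linarith
      qed
      then show ?thesis by (intro flux_pos_imp_pos[OF reg sol init(1), of e]) (use t e True in auto)
    next
      case False
      then show ?thesis using r(2)[OF l', of t] x(2)[of t] t e by auto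
    qed
  qed
qed

text \<open>Picone's inequality for one fixed bump supported where \<open>w > 0\<close> bounds \<open>l\<close> by the quotient of the energy
of the bump and its weighted norm.\<close>

lemma positive_solution_parameter_bounded:
  assumes reg: "regular p q w c d" and w: "\<exists>t\<in>{c<..<d}. w t > 0"
  obtains L where "\<And>l u y. solution p q w l c d u y \<Longrightarrow> (\<And>t. t \<in> {c<..<d} \<Longrightarrow> u t > 0) \<Longrightarrow> l \<le> L"
proof -
  obtain t0 where t0: "t0 \<in> {c<..<d}" "w t0 > 0" using w by auto
  have cw: "continuous_on {c..d} w" using reg unfolding regular_def by auto
  then obtain r where r: "r > 0" "\<And>t. t \<in> {c..d} \<Longrightarrow> dist t t0 < r \<Longrightarrow> dist (w t) (w t0) < w t0"
    using t0 unfolding continuous_on_iff by (metis atLeastAtMost_iff greaterThanLessThan_iff less_imp_le)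
  define e where "e = Min {r / 2, (t0 - c) / 2, (d - t0) / 2}"
  have e: "e > 0" "e < r" "e < t0 - c" "e < d - t0" unfolding e_def using r t0 by (auto simp: min_def)
  define c' where "c' = t0 - e"
  define d' where "d' = t0 + e"
  have cd': "c \<le> c'" "c' < d'" "d' \<le> d" unfolding c'_def d'_def using e by auto
  have wpos: "w t > 0" if "t \<in> {c'..d'}" for t
  proof -
    have "t \<in> {c..d}" "dist t t0 < r" using that e unfolding c'_def d'_def by (auto simp: dist_real_def)
    from r(2)[OF this] show ?thesis by (simp add: dist_real_def)
  qed
  note reg' = regular_subinterval[OF reg cd']
  \<comment> \<open>A parabola vanishing at both ends of \<open>[c', d']\<close>, on which \<open>w\<close> is positive.\<close>
  define v where "v = (\<lambda>t. (t - c') * (d' - t))"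
  define v' where "v' = (\<lambda>t. c' + d' - 2 * t)"
  define W where "W = integral {c'..d'} (\<lambda>t. w t * (v t)\<^sup>2)"
  define E where "E = integral {c'..d'} (\<lambda>t. p t * (v' t)\<^sup>2 + q t * (v t)\<^sup>2)"
  have cont: "continuous_on {c'..d'} (\<lambda>t. w t * (v t)\<^sup>2)" using reg' unfolding regular_def v_def
    by (intro continuous_intros) auto
  have W0: "W \<ge> 0" unfolding W_def using wpos
    by (intro integral_nonneg integrable_continuous_real cont) (simp add: less_imp_le)
  have "W \<noteq> 0"
  proof
    assume "W = 0"
    then have "\<forall>t\<in>{c'..d'}. w t * (v t)\<^sup>2 = 0"
      using integral_eq_0_iff[OF cont cd'(2)] wpos unfolding W_def by (simp add: less_imp_le)
    moreover have "t0 \<in> {c'..d'}" and "v t0 \<noteq> 0" using e unfolding c'_def d'_def v_def by auto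
    ultimately have "w t0 * (v t0)\<^sup>2 = 0" by blast
    then show False using t0 \<open>v t0 \<noteq> 0\<close> by simp
  qed
  then have W: "W > 0" using W0 by simp
  show ?thesis
  proof
    fix l u y assume sol: "solution p q w l c d u y" and pos: "\<And>t. t \<in> {c<..<d} \<Longrightarrow> u t > 0"
    have "l * W \<le> E" unfolding W_def E_def
    proof (rule picone_inequality[OF reg' solution_subinterval[OF sol cd'(1,3)]])
      show "(v has_real_derivative v' t) (at t within {c'..d'})" for t unfolding v_def v'_def
        by (auto intro!: derivative_eq_intros)
      show "continuous_on {c'..d'} v'" unfolding v'_def by (intro continuous_intros)
    qed (use pos cd' in \<open>auto simp: v_def\<close>)
    then show "l \<le> E / W" using W by (simp add: field_simps)
  qed
qed

text \<open>Let \<open>l\<close> be the infimum of the nonnegative parameters whose shooting solution fails to be positive on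
\<open>]c, d]\<close>. It is attained, because positivity is an open condition. For smaller parameters the solutions
are positive, so \<open>U l \<ge> 0\<close> in the limit, and an interior zero of \<open>U l\<close> would be a minimum, hence a double
zero. So \<open>U l\<close> is positive inside and vanishes at \<open>d\<close>. Finally \<open>l > 0\<close>, because a nontrivial solution for the
parameter \<open>0\<close> that vanishes at two points would have energy zero.\<close>

lemma principal_exists:
  assumes reg: "regular p q w c d" and w: "\<exists>t\<in>{c<..<d}. w t > 0"
  obtains l where "l > 0" "principal_eigenvalue p q w c d l"
proof -
  have cd: "c < d" using reg unfolding regular_def by auto
  have "\<exists>u y. solution p q w l c d u y \<and> u c = 0 \<and> y c = 1" for l
    using initial_value_solution[OF reg] by metis
  then obtain U Y where sol: "\<And>l. solution p q w l c d (U l) (Y l)" and init: "\<And>l. U l c = 0" "\<And>l. Y l c = 1"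
    by metis
  define S where "S = {l. l \<ge> 0 \<and> (\<exists>t\<in>{c<..d}. U l t \<le> 0)}"
  obtain L where L: "\<And>l u y. solution p q w l c d u y \<Longrightarrow> (\<And>t. t \<in> {c<..<d} \<Longrightarrow> u t > 0) \<Longrightarrow> l \<le> L"
    using positive_solution_parameter_bounded[OF reg w] by blast
  have "\<bar>L\<bar> + 1 \<in> S"
  proof (rule ccontr)
    assume "\<bar>L\<bar> + 1 \<notin> S"
    then have "\<bar>L\<bar> + 1 \<le> L" by (intro L[OF sol]) (force simp: S_def)
    then show False by linarith
  qed
  then have ne: "S \<noteq> {}" by blast
  have bdd: "bdd_below S" unfolding S_def by (rule bdd_belowI[of _ 0]) auto
  define l where "l = Inf S"
  have l0: "l \<ge> 0" unfolding l_def by (rule cInf_greatest[OF ne]) (auto simp: S_def)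
  have lower: "l \<le> s" if "s \<in> S" for s unfolding l_def using that bdd by (rule cInf_lower)
  have "\<exists>t\<in>{c<..d}. U l t \<le> 0"
  proof (rule ccontr)
    assume "\<not> ?thesis"
    then obtain r where r: "r > 0" "\<And>l'. \<bar>l' - l\<bar> < r \<Longrightarrow> \<forall>t\<in>{c<..d}. U l' t > 0"
      using shooting_pos_open[OF reg sol init, of l] by (auto simp: not_le)
    obtain s where s: "s \<in> S" "s < l + r" using cInf_lessD[OF ne, of "l + r"] r(1) unfolding l_def by auto
    then have "\<bar>s - l\<bar> < r" using lower[OF s(1)] by auto
    then show False using r(2) s(1) unfolding S_def by force
  qed
  then obtain t where "t \<in> {c<..d}" "U l t \<le> 0" by blast
  moreover have "Y l c > 0" by (simp add: init)
  ultimately obtain z where z: "z \<in> {c<..t}" "U l z = 0" "\<And>s. s \<in> {c<..<z} \<Longrightarrow> U l s > 0" and td: "t \<le> d"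
    using solution_first_zero[OF reg sol init(1), of l t] by auto
  have zd: "z \<le> d" "c < z" using z td by auto
  note regz = regular_subinterval[OF reg order_refl zd(2,1)]
    and solz = solution_subinterval[OF sol[of l] order_refl zd(1)]
  have mid: "(c + z) / 2 \<in> {c..z}" "U l ((c + z) / 2) \<noteq> 0" using zd z(3)[of "(c + z) / 2"] by auto
  have "l \<noteq> 0" using zero_not_eigenvalue[OF regz _ init(1)[of l] z(2) mid(1)] solz mid(2) by auto
  then have lpos: "l > 0" using l0 by simp
  have nonneg: "U l s \<ge> 0" if s: "s \<in> {c<..d}" for s
  proof (rule ccontr)
    assume "\<not> ?thesis"
    then obtain r where r: "r > 0" "\<And>l'. \<bar>l' - l\<bar> < r \<Longrightarrow> \<forall>t\<in>{c..d}. \<bar>U l' t - U l t\<bar> < - U l s"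
      using shooting_continuous[OF reg sol init, of "- U l s" l] by auto
    define l' where "l' = l - min (r / 2) l"
    have "\<bar>l' - l\<bar> < r" "l' \<ge> 0" "l' < l" unfolding l'_def using r(1) lpos by (auto simp: min_def)
    moreover from this have "\<bar>U l' s - U l s\<bar> < - U l s" using r(2)[of l'] s by auto
    then have "U l' s \<le> 0" by linarith
    ultimately have "l' \<in> S" unfolding S_def using s by auto
    then show False using lower \<open>l' < l\<close> by force
  qed
  have "z = d"
  proof (rule ccontr)
    assume "z \<noteq> d"
    then have z': "c < z" "z < d" using zd by auto
    have "at z within {c..d} = at z" by (intro at_within_interior) (use z' in auto)
    moreover have zcd: "z \<in> {c..d}" using z' by auto
    then have "(U l has_real_derivative Y l z / p z) (at z within {c..d})"
      using sol[of l] unfolding solution_def by blast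
    ultimately have "(U l has_real_derivative Y l z / p z) (at z)" by simp
    then have "Y l z / p z = 0"
      by (rule DERIV_local_min[where d = "min (z - c) (d - z)"])
        (use z' nonneg z(2) in \<open>auto simp: abs_less_iff\<close>)
    moreover have "p z > 0" using reg zcd unfolding regular_def by blast
    ultimately have "Y l z = 0" by simp
    then show False using solution_zero_right[OF regz solz z(2) _ mid(1)] mid(2) by auto
  qed
  then show ?thesis using that[OF lpos] sol init(1) z unfolding principal_eigenvalue_def by blast
qed

section \<open>Dependence of principal eigenvalues on the interval\<close>

text \<open>Continuity from the left in the right endpoint: every value above a positive principal eigenvalue is
attained on a shorter interval with the same left end. The shooting solution for \<open>l'\<close> must have a zero before \<open>d\<close>, as otherwise
comparison on \<open>[c, d]\<close> would give \<open>l' \<le> l\<close>; its first zero is the new endpoint.\<close>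

lemma principal_right_endpoint:
  assumes reg: "regular p q w c d" and pr: "principal_eigenvalue p q w c d l" and l: "0 < l" "l < l'"
  obtains z where "z \<in> {c<..<d}" "principal_eigenvalue p q w c z l'"
proof -
  obtain u y where u: "solution p q w l c d u y" "u c = 0" "u d = 0" "\<forall>t\<in>{c<..<d}. u t > 0"
    using pr unfolding principal_eigenvalue_def by blast
  have cd: "c < d" using reg unfolding regular_def by auto
  then have "(c + d) / 2 \<in> {c<..<d}" by auto
  then have mid: "(c + d) / 2 \<in> {c..d}" "u ((c + d) / 2) \<noteq> 0" using u(4) by fastforce+
  obtain v z where v: "solution p q w l' c d v z" "v c = 0" "z c = 1"
    using initial_value_solution[OF reg] by metis
  have "\<exists>t\<in>{c<..<d}. v t \<le> 0"
  proof (rule ccontr)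
    assume "\<not> ?thesis"
    then have "l' \<le> l" by (intro positive_solution_parameter_le[OF reg v(1) _ u(1-3) mid l(1)]) (auto simp: not_le)
    then show False using l by simp
  qed
  then obtain t where t: "t \<in> {c<..<d}" "v t \<le> 0" by blast
  obtain x where x: "x \<in> {c<..t}" "v x = 0" "\<And>s. s \<in> {c<..<x} \<Longrightarrow> v s > 0"
    using solution_first_zero[OF reg v(1,2), of t] v(3) t by auto
  have "x \<in> {c<..<d}" using x t by auto
  moreover have "principal_eigenvalue p q w c x l'" unfolding principal_eigenvalue_def
    using solution_subinterval[OF v(1) order_refl, of x] x t v(2) by auto
  ultimately show ?thesis by (rule that)
qed

text \<open>If \<open>w\<close> is positive at most up to \<open>s\<close>, then the energy \<open>E = b \<integral> w u\<^sup>2\<close> is bounded by the integral over \<open>[z, s]\<close>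
alone. There \<open>u\<^sup>2\<close> is at most a constant times \<open>E\<close>, so \<open>E \<le> b K E (s - z)\<close>.\<close>

lemma principal_blowup:
  assumes reg: "regular p q w c d" and s: "s \<in> {c<..d}" and neg: "\<And>t. t \<in> {s<..<d} \<Longrightarrow> w t \<le> 0"
  obtains K where "K > 0" "\<And>z b. z \<in> {c..<s} \<Longrightarrow> principal_eigenvalue p q w z d b \<Longrightarrow> b > 0 \<Longrightarrow> 1 \<le> b * (K * (s - z))"
proof -
  obtain P where P: "P > 0" "\<And>t. t \<in> {c..d} \<Longrightarrow> P \<le> p t" using regular_lower_bound[OF reg] by blast
  obtain N where N: "N > 0" "\<And>t. t \<in> {c..d} \<Longrightarrow> \<bar>w t\<bar> \<le> N"
    using continuous_bounded_interval[of c d w] reg unfolding regular_def by blast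
  have cd: "c < d" using reg unfolding regular_def by auto
  define K where "K = N * (d - c) / P"
  show ?thesis
  proof
    show "K > 0" unfolding K_def using N P cd by simp
    fix z b assume z: "z \<in> {c..<s}" and pr: "principal_eigenvalue p q w z d b" and b: "b > 0"
    have zd: "c \<le> z" "z < d" using z s by auto
    note regz = regular_subinterval[OF reg zd order_refl]
    obtain u y where u: "solution p q w b z d u y" "u z = 0" "u d = 0" "\<forall>t\<in>{z<..<d}. u t > 0"
      using pr unfolding principal_eigenvalue_def by blast
    have "(z + d) / 2 \<in> {z<..<d}" using zd by auto
    then have mid: "(z + d) / 2 \<in> {z..d}" "u ((z + d) / 2) \<noteq> 0" using u(4) by fastforce+
    define E where "E = energy p q z d u y"
    have E: "E > 0" unfolding E_def by (rule energy_pos[OF regz u(1,2) mid])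
    define f where "f = (\<lambda>t. w t * (u t)\<^sup>2)"
    have "continuous_on {z..d} f" unfolding f_def
      using regz solution_continuous[OF u(1)] unfolding regular_def by (intro continuous_intros) auto
    then have fi: "f integrable_on {z..d}" by (rule integrable_continuous_real)
    have fi1: "f integrable_on {z..s}" and fi2: "f integrable_on {s..d}"
      by (rule integrable_on_subinterval[OF fi]; use z s in auto)+
    have "integral {z..s} f \<le> integral {z..s} (\<lambda>t. K * E)"
    proof (rule integral_le[OF fi1])
      fix t assume t: "t \<in> {z..s}"
      then have t': "t \<in> {z..d}" "t \<in> {c..d}" using z s by auto
      have "P * (u t)\<^sup>2 \<le> (t - z) * E" unfolding E_def
        by (rule energy_bound[OF regz u(1,2) P(2,1) t'(1)]) (use z in auto)
      also have "\<dots> \<le> (d - c) * E" using E t' z by (intro mult_right_mono) auto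
      finally have 1: "(u t)\<^sup>2 \<le> (d - c) * E / P" using P by (simp add: field_simps)
      have "f t \<le> N * (u t)\<^sup>2" unfolding f_def using N(2)[OF t'(2)] by (intro mult_right_mono) auto
      also have "\<dots> \<le> N * ((d - c) * E / P)" using 1 N by (intro mult_left_mono) auto
      finally show "f t \<le> K * E" unfolding K_def by simp
    qed auto
    also have "\<dots> = K * E * (s - z)" using z by simp
    finally have 1: "integral {z..s} f \<le> K * E * (s - z)" .
    have "integral {s<..<d} f \<le> integral {s<..<d} (\<lambda>t. 0)"
      by (rule integral_le) (use fi2 neg in \<open>auto simp: integrable_on_open_interval_real f_def mult_nonpos_nonneg\<close>)
    then have "integral {s..d} f \<le> 0" by (simp add: integral_open_interval_real)
    moreover have "integral {z..d} f = integral {z..s} f + integral {s..d} f"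
      using Henstock_Kurzweil_Integration.integral_combine[OF _ _ fi] z s by auto
    ultimately have "integral {z..d} f \<le> K * E * (s - z)" using 1 by simp
    then have "b * integral {z..d} f \<le> b * (K * E * (s - z))" using b by (intro mult_left_mono) auto
    moreover have "E = b * integral {z..d} f" unfolding E_def f_def by (rule energy_eq[OF regz u(1-3)])
    ultimately have "1 * E \<le> b * (K * (s - z)) * E" by (simp add: mult_ac)
    then show "1 \<le> b * (K * (s - z))" using E by (simp only: mult_le_cancel_right_pos)
  qed
qed

section \<open>The boundary value problems in terms of the flux system\<close>

lemma deriv_on_eq:
  assumes "c < d" "t \<in> {c..d}" "(f has_real_derivative D) (at t within {c..d})"
  shows "deriv_on {c..d} f t = D"
  using assms unfolding deriv_on_def
  by (intro vector_derivative_within_closed_interval) (auto simp: has_real_derivative_iff_has_vector_derivative)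

lemma C1_onD:
  assumes "C1_on S f" "t \<in> S"
  shows "(f has_real_derivative deriv_on S f t) (at t within S)"
  using assms unfolding C1_on_def deriv_on_def differentiable_on_def
    has_real_derivative_iff_has_vector_derivative by (auto simp: vector_derivative_works)

lemma C1_onI:
  assumes "c < d" "\<And>t. t \<in> {c..d} \<Longrightarrow> (f has_real_derivative f' t) (at t within {c..d})" "continuous_on {c..d} f'"
  shows "C1_on {c..d} f"
proof -
  have "f differentiable_on {c..d}" unfolding differentiable_on_def
    using assms(2) unfolding real_differentiable_def by blast
  moreover have "continuous_on {c..d} (deriv_on {c..d} f)"
    using assms(3) by (rule continuous_on_eq) (use deriv_on_eq[OF assms(1) _ assms(2)] in auto)
  ultimately show ?thesis unfolding C1_on_def by blast
qed

lemma continuous_eq_on_closed_interval: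
  fixes f g :: "real \<Rightarrow> real"
  assumes "c < d" "continuous_on {c..d} f" "continuous_on {c..d} g"
    and "\<And>t. t \<in> {c<..<d} \<Longrightarrow> f t = g t" and "t \<in> {c..d}"
  shows "f t = g t"
proof -
  have cl: "closure {c<..<d} = {c..d}" using assms(1) by simp
  have "continuous_on (closure {c<..<d}) (\<lambda>t. f t - g t)" unfolding cl by (intro continuous_intros assms(2,3))
  moreover have "f x - g x = 0" if "x \<in> {c<..<d}" for x using assms(4)[OF that] by simp
  moreover have "t \<in> closure {c<..<d}" unfolding cl by (rule assms(5))
  ultimately have "f t - g t = 0" by (rule continuous_constant_on_closure)
  then show ?thesis by simp
qed

text \<open>The equation is given on the open interval only. Both sides of \<open>y' = F\<close> are continuous on the closed
interval, so that it extends to the endpoints. \<open>F\<close> is arbitrary because the lemma serves the linear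
eigenvalue equation as well as the piecewise linear problem \<open>(P)\<close>.\<close>

lemma admissible_imp_flux:
  assumes cd: "c < d" and p: "\<And>t. t \<in> {c..d} \<Longrightarrow> p t > 0"
    and adm: "admissible p c d u" and F: "continuous_on {c..d} F"
    and eq: "\<And>t. t \<in> {c<..<d} \<Longrightarrow> L_op p q c d u t = q t * u t - F t"
    and t: "t \<in> {c..d}"
  shows "(u has_real_derivative (p t * deriv_on {c..d} u t) / p t) (at t within {c..d})"
    and "((\<lambda>t. p t * deriv_on {c..d} u t) has_real_derivative F t) (at t within {c..d})"
proof -
  define y where "y = (\<lambda>t. p t * deriv_on {c..d} u t)"
  have C1: "C1_on {c..d} u" "C1_on {c..d} y" using adm unfolding admissible_def y_def by auto
  show "(u has_real_derivative (p t * deriv_on {c..d} u t) / p t) (at t within {c..d})"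
    using C1_onD[OF C1(1) t] p[OF t] by simp
  have "deriv_on {c..d} y t = F t"
  proof (rule continuous_eq_on_closed_interval[OF cd _ F _ t])
    show "continuous_on {c..d} (deriv_on {c..d} y)" using C1 unfolding C1_on_def by auto
    show "deriv_on {c..d} y t = F t" if "t \<in> {c<..<d}" for t
      using eq[OF that] unfolding L_op_def y_def by simp
  qed
  then show "((\<lambda>t. p t * deriv_on {c..d} u t) has_real_derivative F t) (at t within {c..d})"
    using C1_onD[OF C1(2) t] unfolding y_def by simp
qed

lemma flux_imp_admissible:
  assumes cd: "c < d" and p: "\<And>t. t \<in> {c..d} \<Longrightarrow> p t > 0" "continuous_on {c..d} p"
    and u: "\<And>t. t \<in> {c..d} \<Longrightarrow> (u has_real_derivative y t / p t) (at t within {c..d})"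
    and y: "\<And>t. t \<in> {c..d} \<Longrightarrow> (y has_real_derivative F t) (at t within {c..d})"
    and F: "continuous_on {c..d} F"
  shows "admissible p c d u" and "t \<in> {c..d} \<Longrightarrow> L_op p q c d u t = q t * u t - F t"
    and "t \<in> {c..d} \<Longrightarrow> deriv_on {c..d} u t = y t / p t"
proof -
  have d: "deriv_on {c..d} u t = y t / p t" if "t \<in> {c..d}" for t by (rule deriv_on_eq[OF cd that u[OF that]])
  then show "t \<in> {c..d} \<Longrightarrow> deriv_on {c..d} u t = y t / p t" .
  have y': "((\<lambda>t. p t * deriv_on {c..d} u t) has_real_derivative F t) (at t within {c..d})" if "t \<in> {c..d}" for t
    by (rule has_field_derivative_transform_within[OF y[OF that] zero_less_one that]) (use d p in force)
  have "continuous_on {c..d} (\<lambda>t. y t / p t)"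
    using p DERIV_continuous_on[OF y] by (intro continuous_intros) force+
  then show "admissible p c d u" unfolding admissible_def
    using C1_onI[OF cd u] C1_onI[OF cd y' F] by auto
  show "L_op p q c d u t = q t * u t - F t" if "t \<in> {c..d}"
    unfolding L_op_def using deriv_on_eq[OF cd that y'[OF that]] by simp
qed

lemma eigenvalue_iff_solution:
  assumes "regular p q w c d"
  shows "eigenvalue p q w c d l \<longleftrightarrow>
    (\<exists>u y. solution p q w l c d u y \<and> u c = 0 \<and> u d = 0 \<and> (\<exists>t\<in>{c..d}. u t \<noteq> 0))" (is "_ \<longleftrightarrow> ?R")
proof -
  have cd: "c < d" and p: "\<And>t. t \<in> {c..d} \<Longrightarrow> p t > 0" "continuous_on {c..d} p"
    using assms unfolding regular_def by auto
  have F: "continuous_on {c..d} (\<lambda>t. (q t - l * w t) * u t)" if "continuous_on {c..d} u" for u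
    using assms that unfolding regular_def by (intro continuous_intros) auto
  show ?thesis
  proof
    assume "eigenvalue p q w c d l"
    then obtain u where u: "admissible p c d u" "\<And>t. t \<in> {c<..<d} \<Longrightarrow> L_op p q c d u t = l * w t * u t"
      "u c = 0" "u d = 0" "\<exists>t\<in>{c..d}. u t \<noteq> 0"
      unfolding eigenvalue_def by blast
    have "continuous_on {c..d} u" using u(1) unfolding admissible_def C1_on_def
      by (auto intro: differentiable_imp_continuous_on)
    note Fu = F[OF this]
    have L: "L_op p q c d u t = q t * u t - (q t - l * w t) * u t" if "t \<in> {c<..<d}" for t
      using u(2)[OF that] by (simp add: algebra_simps)
    have "solution p q w l c d u (\<lambda>t. p t * deriv_on {c..d} u t)" unfolding solution_def
      by (intro ballI conjI admissible_imp_flux[OF cd p(1) u(1) Fu L])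
    then show ?R using u(3-5) by blast
  next
    assume ?R
    then obtain u y where u: "solution p q w l c d u y" "u c = 0" "u d = 0" "\<exists>t\<in>{c..d}. u t \<noteq> 0" by blast
    note * = flux_imp_admissible[OF cd p, where u = u and y = y and F = "\<lambda>t. (q t - l * w t) * u t"]
    note Fu = F[OF solution_continuous(1)[OF u(1)]]
    have "admissible p c d u" by (rule *) (use u(1) Fu in \<open>auto simp: solution_def\<close>)
    moreover have "L_op p q c d u t = l * w t * u t" if "t \<in> {c<..<d}" for t
    proof -
      have "L_op p q c d u t = q t * u t - (q t - l * w t) * u t"
        by (rule *) (use u(1) Fu that in \<open>auto simp: solution_def\<close>)
      then show ?thesis by (simp add: algebra_simps)
    qed
    ultimately show "eigenvalue p q w c d l" unfolding eigenvalue_def using u by blast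
  qed
qed

lemma principal_imp_eigenvalue:
  assumes "regular p q w c d" "principal_eigenvalue p q w c d l"
  shows "eigenvalue p q w c d l"
proof -
  obtain u y where u: "solution p q w l c d u y" "u c = 0" "u d = 0" "\<forall>t\<in>{c<..<d}. u t > 0"
    using assms(2) unfolding principal_eigenvalue_def by blast
  have "(c + d) / 2 \<in> {c<..<d}" using assms(1) unfolding regular_def by auto
  then have "(c + d) / 2 \<in> {c..d}" "u ((c + d) / 2) \<noteq> 0" using u(4) by fastforce+
  then show ?thesis unfolding eigenvalue_iff_solution[OF assms(1)] using u by blast
qed

text \<open>This holds for all positive eigenvalues, whatever the sign of their eigenfunctions, and so identifies
\<open>l\<close> with the least one.\<close>

lemma principal_le_eigenvalue:
  assumes reg: "regular p q w c d" and pr: "principal_eigenvalue p q w c d l"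
    and k: "eigenvalue p q w c d k" "k > 0"
  shows "l \<le> k"
proof -
  obtain v y t where v: "solution p q w k c d v y" "v c = 0" "v d = 0" "t \<in> {c..d}" "v t \<noteq> 0"
    using k(1) unfolding eigenvalue_iff_solution[OF reg] by blast
  obtain u z where u: "solution p q w l c d u z" "\<forall>t\<in>{c<..<d}. u t > 0"
    using pr unfolding principal_eigenvalue_def by blast
  show ?thesis by (rule positive_solution_parameter_le[OF reg u(1) _ v]) (use u(2) k in auto)
qed

lemma lam_pos_eq_principal:
  assumes reg: "regular p q w c d" and pr: "principal_eigenvalue p q w c d l" and l: "l > 0"
  shows "lam_pos p q w c d = l"
  unfolding lam_pos_def
  by (rule Least_equality) (use principal_imp_eigenvalue[OF reg pr] principal_le_eigenvalue[OF reg pr] l in auto)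

lemma eigenvalue_neg: "eigenvalue p q (\<lambda>t. - w t) c d (- l) \<longleftrightarrow> eigenvalue p q w c d l"
  unfolding eigenvalue_def by simp

lemma regular_neg: "regular p q (\<lambda>t. - w t) c d \<longleftrightarrow> regular p q w c d"
proof -
  have "continuous_on {c..d} (\<lambda>t. - w t) \<longleftrightarrow> continuous_on {c..d} w"
    using continuous_on_minus[of "{c..d}" w] continuous_on_minus[of "{c..d}" "\<lambda>t. - w t"] by auto
  then show ?thesis unfolding regular_def by simp
qed

lemma lam_neg_eq_principal:
  assumes reg: "regular p q w c d" and pr: "principal_eigenvalue p q (\<lambda>t. - w t) c d l" and l: "l > 0"
  shows "lam_neg p q w c d = - l"
  unfolding lam_neg_def
proof (rule Greatest_equality)
  have reg': "regular p q (\<lambda>t. - w t) c d" using reg by (simp add: regular_neg)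
  show "- l < 0 \<and> eigenvalue p q w c d (- l)"
    using principal_imp_eigenvalue[OF reg' pr] eigenvalue_neg[of p q w c d "- l"] l by simp
  fix k assume "k < 0 \<and> eigenvalue p q w c d k"
  then show "k \<le> - l" using principal_le_eigenvalue[OF reg' pr, of "- k"] by (simp add: eigenvalue_neg)
qed

section \<open>The curves as pairs of principal eigenvalues\<close>

lemma positive_between_zeros:
  fixes u :: "real \<Rightarrow> real"
  assumes "continuous_on {c..d} u" "u c = 0" "\<And>t. t \<in> {c<..<d} \<Longrightarrow> u t \<noteq> 0"
    and D: "(u has_real_derivative D) (at c within {c..d})" "D > 0" and t: "t \<in> {c<..<d}"
  shows "u t > 0"
proof (rule ccontr)
  assume n: "\<not> u t > 0"
  obtain r where r: "r > 0" "\<And>h. h > 0 \<Longrightarrow> c + h \<in> {c..d} \<Longrightarrow> h < r \<Longrightarrow> u c < u (c + h)"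
    using has_real_derivative_pos_inc_right[OF D] by auto
  define s where "s = c + min (r / 2) ((t - c) / 2)"
  have s: "s \<in> {c<..<t}" unfolding s_def using r t by (auto simp: min_def field_simps)
  have "u s > 0" using r(2)[of "min (r / 2) ((t - c) / 2)"] r(1) t s assms(2) unfolding s_def by (auto simp: min_def)
  then obtain x where "s \<le> x" "x \<le> t" "u x = 0"
    using IVT2'[of u t 0 s] n s t continuous_on_subset[OF assms(1), of "{s..t}"] by force
  then show False using assms(3)[of x] s t by auto
qed

lemma has_real_derivative_glue:
  fixes f g :: "real \<Rightarrow> real"
  assumes z: "z \<in> {c<..<d}"
    and f: "\<And>t. t \<in> {c..z} \<Longrightarrow> (f has_real_derivative f' t) (at t within {c..z})"
    and g: "\<And>t. t \<in> {z..d} \<Longrightarrow> (g has_real_derivative g' t) (at t within {z..d})"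
    and fg: "f z = g z" "f' z = g' z" and t: "t \<in> {c..d}"
  shows "((\<lambda>t. if t \<in> {c..z} then f t else g t) has_real_derivative (if t \<in> {c..z} then f' t else g' t))
    (at t within {c..d})"
proof -
  have cl: "closure {z<..d} = {z..d}" "closure {c..z} \<inter> closure {z<..d} = {z}" using z by auto
  have s: "{c..z} \<union> {z} = {c..z}" "{z<..d} \<union> {z} = {z..d}" "{c..z} \<union> {z<..d} = {c..d}" using z by auto
  show ?thesis unfolding has_real_derivative_iff_has_vector_derivative
  proof (rule has_vector_derivative_If_within_closures[where x = t and S = "{c..z}" and T = "{z<..d}"
        and u = "{c..d}" and f = f and f' = f' and g = g and g' = g'])
    show "t \<in> {c..z} \<union> {z<..d}" unfolding s(3) by (rule t)
    show "{c..d} = {c..z} \<union> {z<..d}" by (rule s(3)[symmetric])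
    show "(f has_vector_derivative f' t) (at t within {c..z} \<union> closure {c..z} \<inter> closure {z<..d})"
      if "t \<in> {c..z} \<union> closure {c..z} \<inter> closure {z<..d}"
      using f that unfolding cl(2) s has_real_derivative_iff_has_vector_derivative by blast
    show "(g has_vector_derivative g' t) (at t within {z<..d} \<union> closure {c..z} \<inter> closure {z<..d})"
      if "t \<in> {z<..d} \<union> closure {c..z} \<inter> closure {z<..d}"
      using g that unfolding cl(2) s has_real_derivative_iff_has_vector_derivative by blast
    show "f t = g t" "f' t = g' t" if "t \<in> closure {c..z}" "t \<in> closure {z<..d}"
    proof -
      have "t = z" using that cl by auto
      then show "f t = g t" "f' t = g' t" using fg by auto
    qed
  qed
qed

definition junction_curve where
  "junction_curve p q m n T1 T2 =
     {(a, b). \<exists>z\<in>{T1<..<T2}. principal_eigenvalue p q m T1 z a \<and> principal_eigenvalue p q n z T2 b}"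

text \<open>The zero \<open>z\<close> splits \<open>u\<close> into its two bumps. Uniqueness for the linear equation on \<open>[T1, z]\<close> makes the zero
simple, so \<open>u\<close> changes sign at \<open>z\<close> and is negative on the whole of \<open>]z, T2[\<close>.\<close>

lemma solves_P_imp_junction:
  assumes regm: "regular p q m T1 T2" and regn: "regular p q n T1 T2"
    and P: "solves_P p q m n T1 T2 a b u" and ex1: "\<exists>!t. t \<in> {T1<..<T2} \<and> u t = 0"
    and d1: "deriv_on {T1..T2} u T1 > 0"
  shows "(a, b) \<in> junction_curve p q m n T1 T2"
proof -
  have T: "T1 < T2" and p: "\<And>t. t \<in> {T1..T2} \<Longrightarrow> p t > 0"
    and cont: "continuous_on {T1..T2} q" "continuous_on {T1..T2} m" "continuous_on {T1..T2} n"
    using regm regn unfolding regular_def by auto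
  define F where "F = (\<lambda>t. q t * u t - (a * m t * pos_part u t - b * n t * neg_part u t))"
  define y where "y = (\<lambda>t. p t * deriv_on {T1..T2} u t)"
  have adm: "admissible p T1 T2 u" and u0: "u T1 = 0" "u T2 = 0" using P unfolding solves_P_def by auto
  have cu: "continuous_on {T1..T2} u" using adm unfolding admissible_def C1_on_def
    by (auto intro: differentiable_imp_continuous_on)
  then have cF: "continuous_on {T1..T2} F" unfolding F_def pos_part_def neg_part_def
    by (intro continuous_intros cont)
  have L: "L_op p q T1 T2 u t = q t * u t - F t" if "t \<in> {T1<..<T2}" for t
    using P that unfolding solves_P_def F_def by auto
  have du: "(u has_real_derivative y t / p t) (at t within {T1..T2})"
    and dy: "(y has_real_derivative F t) (at t within {T1..T2})" if "t \<in> {T1..T2}" for t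
    unfolding y_def using p that by (blast intro: admissible_imp_flux(1)[OF T _ adm cF L]
      admissible_imp_flux(2)[OF T _ adm cF L])+
  obtain z where z: "z \<in> {T1<..<T2}" "u z = 0" and uniq: "\<And>t. t \<in> {T1<..<T2} \<Longrightarrow> u t = 0 \<Longrightarrow> t = z"
    using ex1 by blast
  have sub: "{T1..z} \<subseteq> {T1..T2}" "{z..T2} \<subseteq> {T1..T2}" using z by auto
  have y1: "y T1 / p T1 > 0" using d1 p[of T1] T unfolding y_def by auto
  have nz: "u t \<noteq> 0" if "t \<in> {T1<..<z} \<or> t \<in> {z<..<T2}" for t
  proof
    assume "u t = 0"
    moreover have "t \<in> {T1<..<T2}" using that z by auto
    ultimately show False using uniq that by force
  qed
  have pos: "u t > 0" if "t \<in> {T1<..<z}" for t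
    by (rule positive_between_zeros[OF continuous_on_subset[OF cu sub(1)] u0(1) _ DERIV_subset[OF du sub(1)] y1 that])
      (use nz z in auto)
  have sol1: "solution p q m a T1 z u y" unfolding solution_def
  proof (intro ballI conjI)
    fix t assume t: "t \<in> {T1..z}"
    then have t': "t \<in> {T1..T2}" using sub by auto
    show "(u has_real_derivative y t / p t) (at t within {T1..z})" using DERIV_subset[OF du[OF t'] sub(1)] .
    have "u t \<ge> 0" using pos[of t] t u0 z by (cases "t = T1 \<or> t = z") (auto simp: less_imp_le)
    then have "F t = (q t - a * m t) * u t" unfolding F_def pos_part_def neg_part_def by (simp add: algebra_simps)
    then show "(y has_real_derivative (q t - a * m t) * u t) (at t within {T1..z})"
      using DERIV_subset[OF dy[OF t'] sub(1)] by simp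
  qed
  have Tz: "T1 < z" "z < T2" using z by auto
  note regz = regular_subinterval[OF regm order_refl Tz(1) less_imp_le[OF Tz(2)]]
  have "(T1 + z) / 2 \<in> {T1..z}" "u ((T1 + z) / 2) \<noteq> 0" using pos[of "(T1 + z) / 2"] Tz by auto
  then have "y z \<noteq> 0" using solution_zero_right[OF regz sol1 z(2)] by blast
  moreover have "\<not> y z / p z > 0"
  proof
    assume "y z / p z > 0"
    moreover have "(u has_real_derivative y z / p z) (at z within {T1..z})"
      using sol1 Tz unfolding solution_def by auto
    ultimately obtain r where r: "r > 0" "\<And>h. h > 0 \<Longrightarrow> z - h \<in> {T1..z} \<Longrightarrow> h < r \<Longrightarrow> u (z - h) < u z"
      using has_real_derivative_pos_inc_left by blast
    have "u (z - min (r / 2) ((z - T1) / 2)) < u z" using r(1) Tz by (intro r(2)) (auto simp: min_def field_simps)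
    moreover have "u (z - min (r / 2) ((z - T1) / 2)) > 0"
      using r(1) Tz by (intro pos) (auto simp: min_def field_simps)
    ultimately show False using z by simp
  qed
  moreover have "p z > 0" using p z by auto
  ultimately have yz: "- (y z / p z) > 0"
    by (metis divide_pos_pos linorder_neqE_linordered_idom minus_divide_left neg_0_less_iff_less)
  have neg: "- u t > 0" if "t \<in> {z<..<T2}" for t
  proof (rule positive_between_zeros[where u = "\<lambda>t. - u t" and c = z and d = T2])
    show "((\<lambda>t. - u t) has_real_derivative - (y z / p z)) (at z within {z..T2})"
      by (rule DERIV_minus[OF DERIV_subset[OF du sub(2)]]) (use z in auto)
    show "continuous_on {z..T2} (\<lambda>t. - u t)" by (intro continuous_intros continuous_on_subset[OF cu sub(2)])
    show "- u t \<noteq> 0" if "t \<in> {z<..<T2}" for t using nz[of t] that by auto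
  qed (use z that yz in auto)
  have sol2: "solution p q n b z T2 (\<lambda>t. - u t) (\<lambda>t. - y t)" unfolding solution_def
  proof (intro ballI conjI)
    fix t assume t: "t \<in> {z..T2}"
    then have t': "t \<in> {T1..T2}" using sub by auto
    show "((\<lambda>t. - u t) has_real_derivative - y t / p t) (at t within {z..T2})"
      using DERIV_minus[OF DERIV_subset[OF du[OF t'] sub(2)]] by simp
    have "u t \<le> 0" using neg[of t] t u0 z by (cases "t = T2 \<or> t = z") (auto simp: less_imp_le)
    then have "- F t = (q t - b * n t) * - u t" unfolding F_def pos_part_def neg_part_def by (simp add: algebra_simps)
    then show "((\<lambda>t. - y t) has_real_derivative (q t - b * n t) * - u t) (at t within {z..T2})"
      using DERIV_minus[OF DERIV_subset[OF dy[OF t'] sub(2)]] by simp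
  qed
  have "principal_eigenvalue p q m T1 z a" unfolding principal_eigenvalue_def using sol1 u0 z pos by blast
  moreover have "principal_eigenvalue p q n z T2 b" unfolding principal_eigenvalue_def using sol2 u0 z neg
    by (intro exI[of _ "\<lambda>t. - u t"] exI[of _ "\<lambda>t. - y t"]) auto
  ultimately show ?thesis unfolding junction_curve_def using z by blast
qed

lemma principal_flux_signs:
  assumes reg: "regular p q w c d" and sol: "solution p q w l c d u y" and u0: "u c = 0" "u d = 0"
    and pos: "\<And>t. t \<in> {c<..<d} \<Longrightarrow> u t > 0"
  shows "y c > 0" "y d < 0"
proof -
  have left: "y c > 0" if reg: "regular p q w c d" and sol: "solution p q w l c d u y" and u0: "u c = 0"
    and pos: "\<And>t. t \<in> {c<..<d} \<Longrightarrow> u t > 0" for p q w c d u y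
  proof (rule ccontr)
    assume n: "\<not> y c > 0"
    have cd: "c < d" and pc: "p c > 0" using reg unfolding regular_def by auto
    have "(c + d) / 2 \<in> {c..d}" "u ((c + d) / 2) \<noteq> 0" using pos[of "(c + d) / 2"] cd by auto
    then have "y c \<noteq> 0" using solution_zero_left[OF reg sol u0] by blast
    then have "0 < - (y c / p c)" using n pc by (simp add: divide_neg_pos)
    moreover have "((\<lambda>t. - u t) has_real_derivative - (y c / p c)) (at c within {c..d})"
      by (rule DERIV_minus) (use sol cd in \<open>auto simp: solution_def\<close>)
    moreover have "- u t \<noteq> 0" if "t \<in> {c<..<d}" for t using pos[OF that] by simp
    moreover have "continuous_on {c..d} (\<lambda>t. - u t)" using solution_continuous[OF sol] by (intro continuous_intros)
    ultimately have "- u ((c + d) / 2) > 0"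
      using cd u0 by (intro positive_between_zeros[where u = "\<lambda>t. - u t" and c = c and d = d]) auto
    then show False using pos[of "(c + d) / 2"] cd by auto
  qed
  show "y c > 0" by (rule left[OF reg sol u0(1) pos])
  have "- y (- (- d)) > 0"
    by (rule left[OF regular_reflect[OF reg] solution_reflect[OF sol]]) (use u0 pos in auto)
  then show "y d < 0" by simp
qed

text \<open>The second eigenfunction is multiplied by the negative number that makes the fluxes agree at \<open>z\<close>. Then both
\<open>u\<close> and its flux have a derivative at the junction, since the right-hand sides of the system agree there
as well.\<close>

lemma junction_imp_solves_P:
  assumes regm: "regular p q m T1 T2" and regn: "regular p q n T1 T2"
    and "(a, b) \<in> junction_curve p q m n T1 T2"
  shows "\<exists>u. solves_P p q m n T1 T2 a b u \<and> (\<exists>!t. t \<in> {T1<..<T2} \<and> u t = 0) \<and> deriv_on {T1..T2} u T1 > 0"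
proof -
  obtain z where z: "z \<in> {T1<..<T2}" and pr: "principal_eigenvalue p q m T1 z a" "principal_eigenvalue p q n z T2 b"
    using assms(3) unfolding junction_curve_def by blast
  have T: "T1 < T2" "T1 < z" "z < T2" and p: "\<And>t. t \<in> {T1..T2} \<Longrightarrow> p t > 0" and cp: "continuous_on {T1..T2} p"
    and cont: "continuous_on {T1..T2} q" "continuous_on {T1..T2} m" "continuous_on {T1..T2} n"
    using regm regn z unfolding regular_def by auto
  note reg1 = regular_subinterval[OF regm order_refl T(2) less_imp_le[OF T(3)]]
    and reg2 = regular_subinterval[OF regn less_imp_le[OF T(2)] T(3) order_refl]
  obtain f g where f: "solution p q m a T1 z f g" "f T1 = 0" "f z = 0" "\<And>t. t \<in> {T1<..<z} \<Longrightarrow> f t > 0"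
    using pr(1) unfolding principal_eigenvalue_def by blast
  obtain h k where h: "solution p q n b z T2 h k" "h z = 0" "h T2 = 0" "\<And>t. t \<in> {z<..<T2} \<Longrightarrow> h t > 0"
    using pr(2) unfolding principal_eigenvalue_def by blast
  have gs: "g T1 > 0" "g z < 0" using principal_flux_signs[OF reg1 f] by auto
  have ks: "k z > 0" using principal_flux_signs[OF reg2 h] by auto
  define c where "c = g z / k z"
  have c: "c < 0" "g z = c * k z" unfolding c_def using gs ks by (auto simp: divide_neg_pos)
  note ch = solution_cmult[OF h(1), of c]
  define u where "u = (\<lambda>t. if t \<in> {T1..z} then f t else c * h t)"
  define y where "y = (\<lambda>t. if t \<in> {T1..z} then g t else c * k t)"
  define F where "F = (\<lambda>t. q t * u t - (a * m t * pos_part u t - b * n t * neg_part u t))"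
  have upos: "u t > 0" if "t \<in> {T1<..<z}" for t using f(4)[OF that] that unfolding u_def by auto
  have uneg: "u t < 0" if "t \<in> {z<..<T2}" for t using h(4)[OF that] that c(1) unfolding u_def by (auto simp: mult_neg_pos)
  have u0: "u T1 = 0" "u z = 0" "u T2 = 0" unfolding u_def using f h T by auto
  have F1: "F t = (q t - a * m t) * f t" if t: "t \<in> {T1..z}" for t
  proof -
    have "u t \<ge> 0" using upos[of t] t u0 by (cases "t = T1 \<or> t = z") (auto simp: less_imp_le)
    moreover have "f t = u t" using t unfolding u_def by auto
    ultimately show ?thesis unfolding F_def pos_part_def neg_part_def by (simp add: algebra_simps)
  qed
  have F2: "F t = (q t - b * n t) * (c * h t)" if t: "t \<in> {z..T2}" for t
  proof -
    have "u t \<le> 0" using uneg[of t] t u0 by (cases "t = T2 \<or> t = z") (auto simp: less_imp_le)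
    moreover have "c * h t = u t" using t h f unfolding u_def by auto
    ultimately show ?thesis unfolding F_def pos_part_def neg_part_def by (simp add: algebra_simps)
  qed
  have du: "(u has_real_derivative y t / p t) (at t within {T1..T2})" if t: "t \<in> {T1..T2}" for t
  proof -
    have "(u has_real_derivative (if t \<in> {T1..z} then g t / p t else (c * k t) / p t)) (at t within {T1..T2})"
      unfolding u_def by (rule has_real_derivative_glue[OF z])
        (use f(1) ch t c f(3) h(2) in \<open>auto simp: solution_def\<close>)
    then show ?thesis unfolding y_def by (cases "t \<in> {T1..z}") (simp_all only: if_True if_False)
  qed
  have dy: "(y has_real_derivative F t) (at t within {T1..T2})" if t: "t \<in> {T1..T2}" for t
  proof -
    have "(y has_real_derivative (if t \<in> {T1..z} then (q t - a * m t) * f t else (q t - b * n t) * (c * h t))) (at t within {T1..T2})"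
      unfolding y_def by (rule has_real_derivative_glue[OF z])
        (use f(1) ch t c f(3) h(2) in \<open>auto simp: solution_def\<close>)
    moreover have "(if t \<in> {T1..z} then (q t - a * m t) * f t else (q t - b * n t) * (c * h t)) = F t"
      using F1[of t] F2[of t] t by auto
    ultimately show ?thesis by simp
  qed
  have "continuous_on {T1..T2} F" unfolding F_def pos_part_def neg_part_def
    by (intro continuous_intros cont DERIV_continuous_on[OF du])
  note adm = flux_imp_admissible[OF T(1) p cp du dy this]
  have "solves_P p q m n T1 T2 a b u" unfolding solves_P_def
    using adm(1) adm(2)[of _ q] u0 unfolding F_def by auto
  moreover have "\<exists>!t. t \<in> {T1<..<T2} \<and> u t = 0"
  proof (rule ex1I[of _ z])
    show "z \<in> {T1<..<T2} \<and> u z = 0" using z u0 by simp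
    fix t assume "t \<in> {T1<..<T2} \<and> u t = 0"
    then show "t = z" using upos[of t] uneg[of t] by (cases t z rule: linorder_cases) auto
  qed
  moreover have "deriv_on {T1..T2} u T1 > 0"
    using adm(3)[of T1] gs(1) p[of T1] T unfolding y_def by auto
  ultimately show ?thesis by blast
qed

lemma C2_gt_eq_junction:
  assumes "regular p q m T1 T2" "regular p q n T1 T2"
  shows "C2_gt p q m n T1 T2 = junction_curve p q m n T1 T2"
proof -
  have "(a, b) \<in> C2_gt p q m n T1 T2 \<longleftrightarrow> (a, b) \<in> junction_curve p q m n T1 T2" for a b
  proof
    assume "(a, b) \<in> C2_gt p q m n T1 T2"
    then obtain u where u: "solves_P p q m n T1 T2 a b u" "\<exists>!t. t \<in> {T1<..<T2} \<and> u t = 0"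
        "deriv_on {T1..T2} u T1 > 0"
      unfolding C2_gt_def by (elim CollectE case_prodE exE conjE) (simp only: prod.inject)
    then show "(a, b) \<in> junction_curve p q m n T1 T2" by (rule solves_P_imp_junction[OF assms])
  next
    assume "(a, b) \<in> junction_curve p q m n T1 T2"
    from junction_imp_solves_P[OF assms this] show "(a, b) \<in> C2_gt p q m n T1 T2"
      unfolding C2_gt_def by (simp only: mem_Collect_eq prod.case)
  qed
  then show ?thesis by (intro set_eqI) (simp only: split_paired_all)
qed

section \<open>Negation of solutions and limits along the curves\<close>

lemma C1_on_uminus_cong:
  assumes "c < d" "C1_on {c..d} f" "\<And>t. t \<in> {c..d} \<Longrightarrow> g t = - f t"
  shows "C1_on {c..d} g" and "t \<in> {c..d} \<Longrightarrow> deriv_on {c..d} g t = - deriv_on {c..d} f t"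
proof -
  have d: "(g has_real_derivative - deriv_on {c..d} f t) (at t within {c..d})" if t: "t \<in> {c..d}" for t
    by (rule has_field_derivative_transform_within[OF DERIV_minus[OF C1_onD[OF assms(2) t]] zero_less_one t])
      (use assms(3) in auto)
  have "continuous_on {c..d} (\<lambda>t. - deriv_on {c..d} f t)"
    using assms(2) unfolding C1_on_def by (auto intro: continuous_on_minus)
  with assms(1) d show "C1_on {c..d} g" by (rule C1_onI)
  show "t \<in> {c..d} \<Longrightarrow> deriv_on {c..d} g t = - deriv_on {c..d} f t" using deriv_on_eq[OF assms(1) _ d] .
qed

text \<open>Negation exchanges positive and negative part, hence the roles of \<open>(a, m)\<close> and \<open>(b, n)\<close>.\<close>

lemma solves_P_uminus:
  assumes T: "T1 < T2" and P: "solves_P p q m n T1 T2 a b u"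
  shows "solves_P p q n m T1 T2 b a (\<lambda>t. - u t)"
    and "deriv_on {T1..T2} (\<lambda>t. - u t) T1 = - deriv_on {T1..T2} u T1"
proof -
  define y where "y = (\<lambda>t. p t * deriv_on {T1..T2} u t)"
  define y' where "y' = (\<lambda>t. p t * deriv_on {T1..T2} (\<lambda>t. - u t) t)"
  have C1: "C1_on {T1..T2} u" "C1_on {T1..T2} y"
    using P unfolding solves_P_def admissible_def y_def by auto
  note u = C1_on_uminus_cong[OF T C1(1) refl]
  have "y' t = - y t" if "t \<in> {T1..T2}" for t unfolding y_def y'_def using u(2)[OF that] by simp
  note y = C1_on_uminus_cong[OF T C1(2) this]
  have "L_op p q T1 T2 (\<lambda>t. - u t) t = b * n t * pos_part (\<lambda>t. - u t) t - a * m t * neg_part (\<lambda>t. - u t) t"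
    if t: "t \<in> {T1<..<T2}" for t
  proof -
    have "L_op p q T1 T2 (\<lambda>t. - u t) t = - L_op p q T1 T2 u t"
      unfolding L_op_def y_def[symmetric] y'_def[symmetric] using y(2)[of t] t by simp
    moreover have "L_op p q T1 T2 u t = a * m t * pos_part u t - b * n t * neg_part u t"
      using P t unfolding solves_P_def by blast
    ultimately show ?thesis by (simp add: pos_part_def neg_part_def)
  qed
  then show "solves_P p q n m T1 T2 b a (\<lambda>t. - u t)"
    using P u(1) y(1) unfolding solves_P_def admissible_def y'_def by auto
  show "deriv_on {T1..T2} (\<lambda>t. - u t) T1 = - deriv_on {T1..T2} u T1" using u(2)[of T1] T by simp
qed

lemma C2_lt_eq_swap_C2_gt:
  assumes T: "T1 < T2"
  shows "C2_lt p q m n T1 T2 = prod.swap ` C2_gt p q n m T1 T2"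
proof (rule set_eqI, clarify)
  fix a b
  have "(a, b) \<in> C2_lt p q m n T1 T2 \<longleftrightarrow> (b, a) \<in> C2_gt p q n m T1 T2"
  proof
    assume "(a, b) \<in> C2_lt p q m n T1 T2"
    then obtain u where u: "solves_P p q m n T1 T2 a b u" "\<exists>!t. t \<in> {T1<..<T2} \<and> u t = 0"
        "deriv_on {T1..T2} u T1 < 0"
      unfolding C2_lt_def by (elim CollectE case_prodE exE conjE) (simp only: prod.inject)
    have "\<exists>!t. t \<in> {T1<..<T2} \<and> - u t = 0" using u(2) by (simp only: neg_equal_0_iff_equal)
    moreover have "deriv_on {T1..T2} (\<lambda>t. - u t) T1 > 0" using solves_P_uminus(2)[OF T u(1)] u(3) by simp
    ultimately show "(b, a) \<in> C2_gt p q n m T1 T2" unfolding C2_gt_def mem_Collect_eq prod.case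
      using solves_P_uminus(1)[OF T u(1)] by (intro exI[of _ "\<lambda>t. - u t"] conjI)
  next
    assume "(b, a) \<in> C2_gt p q n m T1 T2"
    then obtain u where u: "solves_P p q n m T1 T2 b a u" "\<exists>!t. t \<in> {T1<..<T2} \<and> u t = 0"
        "deriv_on {T1..T2} u T1 > 0"
      unfolding C2_gt_def by (elim CollectE case_prodE exE conjE) (simp only: prod.inject)
    have "\<exists>!t. t \<in> {T1<..<T2} \<and> - u t = 0" using u(2) by (simp only: neg_equal_0_iff_equal)
    moreover have "deriv_on {T1..T2} (\<lambda>t. - u t) T1 < 0" using solves_P_uminus(2)[OF T u(1)] u(3) by simp
    ultimately show "(a, b) \<in> C2_lt p q m n T1 T2" unfolding C2_lt_def mem_Collect_eq prod.case
      using solves_P_uminus(1)[OF T u(1)] by (intro exI[of _ "\<lambda>t. - u t"] conjI)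
  qed
  then show "((a, b) \<in> C2_lt p q m n T1 T2) = ((a, b) \<in> prod.swap ` C2_gt p q n m T1 T2)"
    by (metis pair_in_swap_image)
qed

text \<open>Both kinds of asymptote are limits of this form, with \<open>f\<close> and \<open>g\<close> the two coordinates in one order or the
other.\<close>

lemma limit_along_set_iff:
  fixes f g :: "'a \<Rightarrow> real"
  defines "F \<equiv> \<lambda>C. inf (filtercomap (\<lambda>z. \<bar>f z\<bar>) at_top) (principal C)"
  shows "F C \<noteq> bot \<and> (g \<longlongrightarrow> l) (F C) \<longleftrightarrow>
    (\<forall>K. \<exists>z\<in>C. K \<le> \<bar>f z\<bar>) \<and> (\<forall>e>0. \<exists>K. \<forall>z\<in>C. K \<le> \<bar>f z\<bar> \<longrightarrow> \<bar>g z - l\<bar> < e)"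
proof -
  have ev: "eventually P (F C) \<longleftrightarrow> (\<exists>K. \<forall>z\<in>C. K \<le> \<bar>f z\<bar> \<longrightarrow> P z)" for P
    unfolding F_def eventually_inf_principal eventually_filtercomap_at_top_linorder by blast
  show ?thesis unfolding trivial_limit_def tendsto_iff ev dist_real_def by blast
qed

lemma asymptotic_vertical_iff:
  "asymptotic_vertical C \<alpha> \<longleftrightarrow> (\<forall>K. \<exists>z\<in>C. K \<le> \<bar>snd z\<bar>) \<and>
     (\<forall>e>0. \<exists>K. \<forall>z\<in>C. K \<le> \<bar>snd z\<bar> \<longrightarrow> \<bar>fst z - \<alpha>\<bar> < e)"
  unfolding asymptotic_vertical_def Let_def by (rule limit_along_set_iff)

lemma asymptotic_horizontal_iff:
  "asymptotic_horizontal C \<beta> \<longleftrightarrow> (\<forall>K. \<exists>z\<in>C. K \<le> \<bar>fst z\<bar>) \<and>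
     (\<forall>e>0. \<exists>K. \<forall>z\<in>C. K \<le> \<bar>fst z\<bar> \<longrightarrow> \<bar>snd z - \<beta>\<bar> < e)"
  unfolding asymptotic_horizontal_def Let_def by (rule limit_along_set_iff)

lemma asymptotic_swap:
  "asymptotic_vertical (prod.swap ` C) \<alpha> \<longleftrightarrow> asymptotic_horizontal C \<alpha>"
  "asymptotic_horizontal (prod.swap ` C) \<alpha> \<longleftrightarrow> asymptotic_vertical C \<alpha>"
  unfolding asymptotic_vertical_iff asymptotic_horizontal_iff by simp_all

lemma asymptotic_scale_sign:
  fixes s r :: real
  assumes "\<bar>s\<bar> = 1" "\<bar>r\<bar> = 1" and C: "C = (\<lambda>(a, b). (s * a, r * b)) ` D"
  shows "asymptotic_vertical D \<alpha> \<Longrightarrow> asymptotic_vertical C (s * \<alpha>)"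
    and "asymptotic_horizontal D \<alpha> \<Longrightarrow> asymptotic_horizontal C (r * \<alpha>)"
  unfolding asymptotic_vertical_iff asymptotic_horizontal_iff C
  using assms by (simp_all add: case_prod_beta abs_mult right_diff_distrib[symmetric])

section \<open>Asymptotes of the curves\<close>

text \<open>Let \<open>s\<close> be the supremum of \<open>{n > 0}\<close> and \<open>z0\<close> the junction of some point of the curve. All junctions of points of \<open>C\<close> lie to
the left of \<open>s\<close>, and every \<open>z\<close> in \<open>[z0, s[\<close> is a junction, since then \<open>m\<close> is positive somewhere before \<open>z\<close>
and \<open>n\<close> somewhere after \<open>z\<close>. Blow-up at \<open>s\<close> makes \<open>b\<close> unbounded on the curve. Conversely a large \<open>b\<close>
forces the junction close to \<open>s\<close> by monotonicity, and then \<open>a\<close> is squeezed between \<open>\<alpha>\<close> and \<open>\<alpha> + e / 2\<close>.\<close>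

lemma junction_vertical_asymptote:
  assumes regm: "regular p q m T1 T2" and regn: "regular p q n T1 T2"
    and C: "C = junction_curve p q m n T1 T2 \<inter> ({0<..} \<times> {0<..})" and ne: "C \<noteq> {}"
  obtains \<alpha> where "\<alpha> > 0" "regular p q m T1 (sup_pos n T1 T2)" "principal_eigenvalue p q m T1 (sup_pos n T1 T2) \<alpha>"
    "asymptotic_vertical C \<alpha>"
proof -
  define A where "A = {t \<in> {T1<..<T2}. n t > 0}"
  define s where "s = sup_pos n T1 T2"
  have sA: "s = Sup A" unfolding s_def sup_pos_def A_def ..
  have bdd: "bdd_above A" unfolding A_def by (rule bdd_aboveI[of _ T2]) auto
  have below: "z < s" if "z \<in> {T1<..<T2}" "principal_eigenvalue p q n z T2 b" "b > 0" for z b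
  proof -
    have "\<exists>t\<in>{z<..<T2}. n t > 0"
      by (rule principal_pos_weight[OF regular_subinterval[OF regn] that(2,3)]) (use that in auto)
    then obtain t where t: "t \<in> {z<..<T2}" "n t > 0" by blast
    then have "t \<in> A" unfolding A_def using that by auto
    from cSup_upper[OF this bdd] show ?thesis using t unfolding sA by simp
  qed
  obtain a0 b0 z0 where z0: "z0 \<in> {T1<..<T2}" "principal_eigenvalue p q m T1 z0 a0" "principal_eigenvalue p q n z0 T2 b0" "a0 > 0" "b0 > 0"
  proof -
    obtain x where "x \<in> C" using ne by blast
    then show ?thesis using that unfolding C junction_curve_def by blast
  qed
  have z0s: "z0 < s" by (rule below[OF z0(1,3,5)])
  have "A \<noteq> {}"
  proof -
    have "\<exists>t\<in>{z0<..<T2}. n t > 0"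
      by (rule principal_pos_weight[OF regular_subinterval[OF regn] z0(3,5)]) (use z0 in auto)
    then show ?thesis unfolding A_def using z0 by auto
  qed
  then have sT: "s \<le> T2" unfolding sA by (rule cSup_least) (auto simp: A_def)
  have neg: "n t \<le> 0" if "t \<in> {s<..<T2}" for t
  proof (rule ccontr)
    assume "\<not> n t \<le> 0"
    then have "t \<in> A" unfolding A_def using that z0 z0s by auto
    then show False using cSup_upper[OF _ bdd, of t] that unfolding sA by auto
  qed
  have mpos: "\<exists>t\<in>{T1<..<z0}. m t > 0"
    by (rule principal_pos_weight[OF regular_subinterval[OF regm] z0(2,4)]) (use z0 in auto)
  have regs: "regular p q m T1 s" by (rule regular_subinterval[OF regm]) (use z0 z0s sT in auto)
  have "\<exists>t\<in>{T1<..<s}. m t > 0" using mpos z0s by force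
  then obtain \<alpha> where \<alpha>: "\<alpha> > 0" "principal_eigenvalue p q m T1 s \<alpha>" using principal_exists[OF regs] by blast
  have point: "\<exists>a b. a > 0 \<and> b > 0 \<and> principal_eigenvalue p q m T1 z a \<and> principal_eigenvalue p q n z T2 b" if z: "z \<in> {z0..<s}" for z
  proof -
    have zT: "T1 < z" "z < T2" using z z0 sT by auto
    have reg: "regular p q m T1 z" "regular p q n z T2"
      by (rule regular_subinterval[OF regm] regular_subinterval[OF regn]; use zT in simp)+
    have "\<exists>t\<in>{T1<..<z}. m t > 0" using mpos z by force
    moreover obtain t where "t \<in> A" "z < t" using less_cSupD[OF \<open>A \<noteq> {}\<close>, of z] z unfolding sA by auto
    then have "\<exists>t\<in>{z<..<T2}. n t > 0" unfolding A_def by auto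
    ultimately show ?thesis using principal_exists[OF reg(1)] principal_exists[OF reg(2)] by metis
  qed
  have onC: "(a, b) \<in> C" if "z \<in> {z0..<s}" "a > 0" "b > 0" "principal_eigenvalue p q m T1 z a" "principal_eigenvalue p q n z T2 b" for z a b
    unfolding C junction_curve_def using that z0(1) sT by force
  obtain k where k: "k > 0" "\<And>z b. z \<in> {T1..<s} \<Longrightarrow> principal_eigenvalue p q n z T2 b \<Longrightarrow> b > 0 \<Longrightarrow> 1 \<le> b * (k * (s - z))"
    using principal_blowup[OF regn, of s] neg z0 z0s sT by auto
  have unbounded: "\<exists>z\<in>C. K \<le> \<bar>snd z\<bar>" for K
  proof -
    define r where "r = 1 / (k * (\<bar>K\<bar> + 1))"
    have r: "r > 0" unfolding r_def using k by (simp add: add_nonneg_pos)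
    define z where "z = max z0 (s - r)"
    have z: "z \<in> {z0..<s}" "s - z \<le> r" unfolding z_def using r z0s by auto
    obtain a b where ab: "a > 0" "b > 0" "principal_eigenvalue p q m T1 z a" "principal_eigenvalue p q n z T2 b" using point[OF z(1)] by blast
    have "1 \<le> b * (k * (s - z))" using k(2)[OF _ ab(4,2)] z z0 by auto
    also have "\<dots> \<le> b * (k * r)" using z ab k by (intro mult_left_mono) auto
    also have "\<dots> = b / (\<bar>K\<bar> + 1)" unfolding r_def using k by simp
    finally have "\<bar>K\<bar> + 1 \<le> b" by (simp add: pos_le_divide_eq add_nonneg_pos)
    then show ?thesis using onC[OF z(1) ab] by force
  qed
  have limit: "\<exists>K. \<forall>z\<in>C. K \<le> \<bar>snd z\<bar> \<longrightarrow> \<bar>fst z - \<alpha>\<bar> < e" if e: "e > 0" for e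
  proof -
    obtain x where x: "x \<in> {T1<..<s}" "principal_eigenvalue p q m T1 x (\<alpha> + e / 2)"
      using principal_right_endpoint[OF regs \<alpha>(2,1), of "\<alpha> + e / 2"] e by auto
    define z1 where "z1 = max x z0"
    have z1: "z1 \<in> {z0..<s}" "x \<le> z1" unfolding z1_def using x z0s by auto
    obtain b1 where b1: "b1 > 0" "principal_eigenvalue p q n z1 T2 b1" using point[OF z1(1)] by blast
    show ?thesis
    proof (intro exI[of _ "b1 + 1"] ballI impI)
      fix ab assume "ab \<in> C" and "b1 + 1 \<le> \<bar>snd ab\<bar>"
      then obtain a b where ab: "(a, b) \<in> C" "ab = (a, b)" and "b1 + 1 \<le> \<bar>b\<bar>" by (cases ab) auto
      then have b: "b > b1" unfolding C by auto
      obtain z where z: "z \<in> {T1<..<T2}" "principal_eigenvalue p q m T1 z a" "principal_eigenvalue p q n z T2 b" "a > 0" "b > 0"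
        using ab(1) unfolding C junction_curve_def by auto
      have zs: "z < s" by (rule below[OF z(1,3,5)])
      have "z > z1"
      proof (rule ccontr)
        assume "\<not> z > z1"
        then have "b \<le> b1"
          by (intro principal_antimono[OF regular_subinterval[OF regn] z(3) _ _ _ b1(2,1)]) (use z z1 sT in auto)
        then show False using b by simp
      qed
      then have "a \<le> \<alpha> + e / 2"
        by (intro principal_antimono[OF regular_subinterval[OF regm] z(2) _ _ _ x(2)]) (use z z1 x e \<alpha> in auto)
      moreover have "\<alpha> \<le> a"
        by (rule principal_antimono[OF regs \<alpha>(2) _ _ _ z(2,4)]) (use z zs in auto)
      ultimately show "\<bar>fst ab - \<alpha>\<bar> < e" using e ab(2) by auto
    qed
  qed
  show ?thesis
    using that[OF \<alpha>(1)] regs \<alpha>(2) unbounded limit unfolding s_def asymptotic_vertical_iff by blast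
qed

lemma junction_curve_reflect:
  assumes "(a, b) \<in> junction_curve p q m n T1 T2"
  shows "(b, a) \<in> junction_curve (\<lambda>t. p (-t)) (\<lambda>t. q (-t)) (\<lambda>t. n (-t)) (\<lambda>t. m (-t)) (-T2) (-T1)"
proof -
  obtain z where z: "z \<in> {T1<..<T2}" "principal_eigenvalue p q m T1 z a" "principal_eigenvalue p q n z T2 b"
    using assms unfolding junction_curve_def by blast
  then have "-z \<in> {-T2<..<-T1}" by auto
  then show ?thesis unfolding junction_curve_def using principal_reflect[OF z(2)] principal_reflect[OF z(3)] by blast
qed

lemma junction_curve_reflect_eq:
  "junction_curve (\<lambda>t. p (-t)) (\<lambda>t. q (-t)) (\<lambda>t. n (-t)) (\<lambda>t. m (-t)) (-T2) (-T1)
    = prod.swap ` junction_curve p q m n T1 T2"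
proof (rule set_eqI, clarify)
  fix b a
  have "(b, a) \<in> junction_curve (\<lambda>t. p (-t)) (\<lambda>t. q (-t)) (\<lambda>t. n (-t)) (\<lambda>t. m (-t)) (-T2) (-T1) \<Longrightarrow>
      (a, b) \<in> junction_curve p q m n T1 T2"
    by (drule junction_curve_reflect) simp
  then show "((b, a) \<in> junction_curve (\<lambda>t. p (-t)) (\<lambda>t. q (-t)) (\<lambda>t. n (-t)) (\<lambda>t. m (-t)) (-T2) (-T1))
     = ((b, a) \<in> prod.swap ` junction_curve p q m n T1 T2)"
    using junction_curve_reflect[of a b p q m n T1 T2] unfolding pair_in_swap_image by blast
qed

lemma sup_pos_reflect: "sup_pos (\<lambda>t. w (-t)) (-T2) (-T1) = - inf_pos w T1 T2"
proof -
  have "{t \<in> {-T2<..<-T1}. w (-t) > 0} = uminus ` {t \<in> {T1<..<T2}. w t > 0}"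
    by (force simp: image_iff intro: exI[of _ "- _"])
  then show ?thesis unfolding sup_pos_def inf_pos_def Inf_real_def by simp
qed

text \<open>Time reversal turns the horizontal asymptote into a vertical one of the swapped curve.\<close>

lemma junction_horizontal_asymptote:
  assumes regm: "regular p q m T1 T2" and regn: "regular p q n T1 T2"
    and C: "C = junction_curve p q m n T1 T2 \<inter> ({0<..} \<times> {0<..})" and ne: "C \<noteq> {}"
  obtains \<beta> where "\<beta> > 0" "regular p q n (inf_pos m T1 T2) T2" "principal_eigenvalue p q n (inf_pos m T1 T2) T2 \<beta>"
    "asymptotic_horizontal C \<beta>"
proof -
  have "prod.swap ` C = junction_curve (\<lambda>t. p (-t)) (\<lambda>t. q (-t)) (\<lambda>t. n (-t)) (\<lambda>t. m (-t)) (-T2) (-T1) \<inter> ({0<..} \<times> {0<..})"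
    unfolding junction_curve_reflect_eq C by force
  moreover have "prod.swap ` C \<noteq> {}" using ne by simp
  ultimately obtain \<beta> where \<beta>: "\<beta> > 0" "regular (\<lambda>t. p (-t)) (\<lambda>t. q (-t)) (\<lambda>t. n (-t)) (-T2) (- inf_pos m T1 T2)"
     "principal_eigenvalue (\<lambda>t. p (-t)) (\<lambda>t. q (-t)) (\<lambda>t. n (-t)) (-T2) (- inf_pos m T1 T2) \<beta>"
     "asymptotic_vertical (prod.swap ` C) \<beta>"
    using junction_vertical_asymptote[OF regular_reflect[OF regn] regular_reflect[OF regm]]
    unfolding sup_pos_reflect by metis
  show ?thesis using that[OF \<beta>(1) _ _ \<beta>(4)[unfolded asymptotic_swap]] regular_reflect[OF \<beta>(2)] principal_reflect[OF \<beta>(3)] by simp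
qed

lemma sup_inf_pos_uminus:
  "inf_pos (\<lambda>t. - w t) T1 T2 = inf_neg w T1 T2" "sup_pos (\<lambda>t. - w t) T1 T2 = sup_neg w T1 T2"
  unfolding inf_pos_def inf_neg_def sup_pos_def sup_neg_def by simp_all

lemma principal_sign:
  fixes s :: real
  assumes "\<bar>s\<bar> = 1"
  shows "principal_eigenvalue p q (\<lambda>t. s * w t) c d (s * l) \<longleftrightarrow> principal_eigenvalue p q w c d l"
proof -
  have "s = 1 \<or> s = -1" using assms by linarith
  then show ?thesis using principal_neg[of p q w c d l] by auto
qed

lemma regular_sign:
  fixes s :: real
  assumes "\<bar>s\<bar> = 1"
  shows "regular p q (\<lambda>t. s * w t) c d \<longleftrightarrow> regular p q w c d"
proof -
  have "s = 1 \<or> s = -1" using assms by linarith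
  then show ?thesis using regular_neg[of p q w c d] by auto
qed

lemma signed_principal_value:
  fixes s :: real
  assumes s: "\<bar>s\<bar> = 1" and reg: "regular p q (\<lambda>t. s * w t) c d"
    and pr: "principal_eigenvalue p q (\<lambda>t. s * w t) c d l" "l > 0"
  shows "s * l = (if s = 1 then lam_pos p q w c d else lam_neg p q w c d)"
proof -
  have "s = 1 \<or> s = -1" using s by linarith
  then show ?thesis
  proof
    assume "s = 1"
    then show ?thesis using lam_pos_eq_principal[of p q w c d l] reg pr by simp
  next
    assume "s = -1"
    then show ?thesis using lam_neg_eq_principal[of p q w c d l] reg pr by (simp add: regular_neg)
  qed
qed

text \<open>The signs \<open>s\<close> and \<open>r\<close> of \<open>a\<close> and \<open>b\<close> are moved onto the weights, so that all quadrants reduce to the first.\<close>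

lemma junction_asymptotes_signed:
  fixes s r :: real
  assumes regm: "regular p q m T1 T2" and regn: "regular p q n T1 T2"
    and sr: "\<bar>s\<bar> = 1" "\<bar>r\<bar> = 1" and S: "\<And>a b. (a, b) \<in> S \<longleftrightarrow> s * a > 0 \<and> r * b > 0"
    and C: "C = junction_curve p q m n T1 T2 \<inter> S" and ne: "C \<noteq> {}"
  shows "asymptotic_horizontal C (if r = 1 then lam_pos p q n (inf_pos (\<lambda>t. s * m t) T1 T2) T2
           else lam_neg p q n (inf_pos (\<lambda>t. s * m t) T1 T2) T2)"
    and "asymptotic_vertical C (if s = 1 then lam_pos p q m T1 (sup_pos (\<lambda>t. r * n t) T1 T2)
           else lam_neg p q m T1 (sup_pos (\<lambda>t. r * n t) T1 T2))"
proof -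
  define D where "D = junction_curve p q (\<lambda>t. s * m t) (\<lambda>t. r * n t) T1 T2 \<inter> ({0<..} \<times> {0<..})"
  have ss: "s * (s * x) = x" "r * (r * x) = x" for x
    using sr by (auto simp: abs_if mult.assoc[symmetric] split: if_splits)
  have CD: "(a, b) \<in> C \<longleftrightarrow> (s * a, r * b) \<in> D" for a b
    unfolding C D_def junction_curve_def using S principal_sign[OF sr(1)] principal_sign[OF sr(2)] by auto
  have img: "C = (\<lambda>(a, b). (s * a, r * b)) ` D"
  proof (rule set_eqI, clarify)
    fix a b
    show "(a, b) \<in> C \<longleftrightarrow> (a, b) \<in> (\<lambda>(a, b). (s * a, r * b)) ` D"
    proof
      assume "(a, b) \<in> C"
      then have "(s * a, r * b) \<in> D" by (simp add: CD)
      then have "(\<lambda>(a, b). (s * a, r * b)) (s * a, r * b) \<in> (\<lambda>(a, b). (s * a, r * b)) ` D" by (rule imageI)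
      then show "(a, b) \<in> (\<lambda>(a, b). (s * a, r * b)) ` D" by (simp add: ss)
    next
      assume "(a, b) \<in> (\<lambda>(a, b). (s * a, r * b)) ` D"
      then show "(a, b) \<in> C" by (auto simp: CD ss)
    qed
  qed
  then have neD: "D \<noteq> {}" using ne by auto
  have reg': "regular p q (\<lambda>t. s * m t) T1 T2" "regular p q (\<lambda>t. r * n t) T1 T2"
    using regm regn regular_sign sr by blast+
  obtain \<alpha> where \<alpha>: "\<alpha> > 0" "regular p q (\<lambda>t. s * m t) T1 (sup_pos (\<lambda>t. r * n t) T1 T2)"
      "principal_eigenvalue p q (\<lambda>t. s * m t) T1 (sup_pos (\<lambda>t. r * n t) T1 T2) \<alpha>" "asymptotic_vertical D \<alpha>"
    using junction_vertical_asymptote[OF reg' D_def neD] by blast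
  show "asymptotic_vertical C (if s = 1 then lam_pos p q m T1 (sup_pos (\<lambda>t. r * n t) T1 T2)
           else lam_neg p q m T1 (sup_pos (\<lambda>t. r * n t) T1 T2))"
    using asymptotic_scale_sign(1)[OF sr img \<alpha>(4)] signed_principal_value[OF sr(1) \<alpha>(2,3,1)] by simp
  obtain \<beta> where \<beta>: "\<beta> > 0" "regular p q (\<lambda>t. r * n t) (inf_pos (\<lambda>t. s * m t) T1 T2) T2"
      "principal_eigenvalue p q (\<lambda>t. r * n t) (inf_pos (\<lambda>t. s * m t) T1 T2) T2 \<beta>" "asymptotic_horizontal D \<beta>"
    using junction_horizontal_asymptote[OF reg' D_def neD] by blast
  show "asymptotic_horizontal C (if r = 1 then lam_pos p q n (inf_pos (\<lambda>t. s * m t) T1 T2) T2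
           else lam_neg p q n (inf_pos (\<lambda>t. s * m t) T1 T2) T2)"
    using asymptotic_scale_sign(2)[OF sr img \<beta>(4)] signed_principal_value[OF sr(2) \<beta>(2,3,1)] by simp
qed

lemma C2_gt_asymptotes:
  fixes s r :: real
  assumes regm: "regular p q m T1 T2" and regn: "regular p q n T1 T2"
    and sr: "\<bar>s\<bar> = 1" "\<bar>r\<bar> = 1" and S: "\<And>a b. (a, b) \<in> S \<longleftrightarrow> s * a > 0 \<and> r * b > 0"
  shows "let C = C2_gt p q m n T1 T2 \<inter> S in C \<noteq> {} \<longrightarrow>
    asymptotic_horizontal C (if r = 1 then lam_pos p q n (inf_pos (\<lambda>t. s * m t) T1 T2) T2
      else lam_neg p q n (inf_pos (\<lambda>t. s * m t) T1 T2) T2) \<and>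
    asymptotic_vertical C (if s = 1 then lam_pos p q m T1 (sup_pos (\<lambda>t. r * n t) T1 T2)
      else lam_neg p q m T1 (sup_pos (\<lambda>t. r * n t) T1 T2))"
  unfolding Let_def C2_gt_eq_junction[OF regm regn]
  by (intro impI conjI junction_asymptotes_signed[OF regm regn sr S refl])

lemma C2_lt_asymptotes:
  fixes s r :: real
  assumes regm: "regular p q m T1 T2" and regn: "regular p q n T1 T2"
    and sr: "\<bar>s\<bar> = 1" "\<bar>r\<bar> = 1" and S: "\<And>a b. (a, b) \<in> S \<longleftrightarrow> s * a > 0 \<and> r * b > 0"
  shows "let C = C2_lt p q m n T1 T2 \<inter> S in C \<noteq> {} \<longrightarrow>
    asymptotic_horizontal C (if r = 1 then lam_pos p q n T1 (sup_pos (\<lambda>t. s * m t) T1 T2)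
      else lam_neg p q n T1 (sup_pos (\<lambda>t. s * m t) T1 T2)) \<and>
    asymptotic_vertical C (if s = 1 then lam_pos p q m (inf_pos (\<lambda>t. r * n t) T1 T2) T2
      else lam_neg p q m (inf_pos (\<lambda>t. r * n t) T1 T2) T2)"
proof -
  have T: "T1 < T2" using regm unfolding regular_def by auto
  define C' where "C' = junction_curve p q n m T1 T2 \<inter> prod.swap ` S"
  have C: "C2_lt p q m n T1 T2 \<inter> S = prod.swap ` C'"
    unfolding C'_def C2_lt_eq_swap_C2_gt[OF T] C2_gt_eq_junction[OF regn regm] by force
  have S': "(b, a) \<in> prod.swap ` S \<longleftrightarrow> r * b > 0 \<and> s * a > 0" for a b
    unfolding pair_in_swap_image using S by blast
  show ?thesis unfolding Let_def C asymptotic_swap image_is_empty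
    by (intro impI conjI junction_asymptotes_signed[OF regn regm sr(2,1) S' C'_def])
qed

theorem theorem5p1:
  fixes p q m n :: "real \<Rightarrow> real" and T1 T2 :: real
  assumes "T1 < T2"
    and "continuous_on {T1..T2} p" and "continuous_on {T1..T2} q"
    and "continuous_on {T1..T2} m" and "continuous_on {T1..T2} n"
    and "\<And>t. t \<in> {T1..T2} \<Longrightarrow> p t > 0"
    and "\<And>t. t \<in> {T1..T2} \<Longrightarrow> q t \<ge> 0"
    and "\<exists>t\<in>{T1..T2}. m t \<noteq> 0"
    and "\<exists>t\<in>{T1..T2}. n t \<noteq> 0"
  shows "(let C = C2_gt p q m n T1 T2 \<inter> ({0<..} \<times> {0<..}) in C \<noteq> {} \<longrightarrow>
       asymptotic_horizontal C (lam_pos p q n (inf_pos m T1 T2) T2) \<and>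
       asymptotic_vertical C (lam_pos p q m T1 (sup_pos n T1 T2))) \<and>
     (let C = C2_lt p q m n T1 T2 \<inter> ({0<..} \<times> {0<..}) in C \<noteq> {} \<longrightarrow>
       asymptotic_horizontal C (lam_pos p q n T1 (sup_pos m T1 T2)) \<and>
       asymptotic_vertical C (lam_pos p q m (inf_pos n T1 T2) T2)) \<and>
     (let C = C2_gt p q m n T1 T2 \<inter> ({..<0} \<times> {..<0}) in C \<noteq> {} \<longrightarrow>
       asymptotic_horizontal C (lam_neg p q n (inf_neg m T1 T2) T2) \<and>
       asymptotic_vertical C (lam_neg p q m T1 (sup_neg n T1 T2))) \<and>
     (let C = C2_lt p q m n T1 T2 \<inter> ({..<0} \<times> {..<0}) in C \<noteq> {} \<longrightarrow>
       asymptotic_horizontal C (lam_neg p q n T1 (sup_neg m T1 T2)) \<and>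
       asymptotic_vertical C (lam_neg p q m (inf_neg n T1 T2) T2)) \<and>
     (let C = C2_gt p q m n T1 T2 \<inter> ({0<..} \<times> {..<0}) in C \<noteq> {} \<longrightarrow>
       asymptotic_horizontal C (lam_neg p q n (inf_pos m T1 T2) T2) \<and>
       asymptotic_vertical C (lam_pos p q m T1 (sup_neg n T1 T2))) \<and>
     (let C = C2_lt p q m n T1 T2 \<inter> ({0<..} \<times> {..<0}) in C \<noteq> {} \<longrightarrow>
       asymptotic_horizontal C (lam_neg p q n T1 (sup_pos m T1 T2)) \<and>
       asymptotic_vertical C (lam_pos p q m (inf_neg n T1 T2) T2)) \<and>
     (let C = C2_gt p q m n T1 T2 \<inter> ({..<0} \<times> {0<..}) in C \<noteq> {} \<longrightarrow>
       asymptotic_horizontal C (lam_pos p q n (inf_neg m T1 T2) T2) \<and>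
       asymptotic_vertical C (lam_neg p q m T1 (sup_pos n T1 T2))) \<and>
     (let C = C2_lt p q m n T1 T2 \<inter> ({..<0} \<times> {0<..}) in C \<noteq> {} \<longrightarrow>
       asymptotic_horizontal C (lam_pos p q n T1 (sup_neg m T1 T2)) \<and>
       asymptotic_vertical C (lam_neg p q m (inf_pos n T1 T2) T2))"
proof -
  have reg: "regular p q m T1 T2" "regular p q n T1 T2" using assms unfolding regular_def by auto
  note gt = C2_gt_asymptotes[OF reg] and lt = C2_lt_asymptotes[OF reg]
  \<comment> \<open>The quantities for negative values of a weight are those for positive values of its negative.\<close>
  show ?thesis unfolding sup_inf_pos_uminus[symmetric]
  proof (intro conjI, goal_cases)
    case 1 show ?case using gt[of 1 1 "{0<..} \<times> {0<..}"] by simp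
  next
    case 2 show ?case using lt[of 1 1 "{0<..} \<times> {0<..}"] by simp
  next
    case 3 show ?case using gt[of "-1" "-1" "{..<0} \<times> {..<0}"] by simp
  next
    case 4 show ?case using lt[of "-1" "-1" "{..<0} \<times> {..<0}"] by simp
  next
    case 5 show ?case using gt[of 1 "-1" "{0<..} \<times> {..<0}"] by simp
  next
    case 6 show ?case using lt[of 1 "-1" "{0<..} \<times> {..<0}"] by simp
  next
    case 7 show ?case using gt[of "-1" 1 "{..<0} \<times> {0<..}"] by simp
  next
    case 8 show ?case using lt[of "-1" 1 "{..<0} \<times> {0<..}"] by simp
  qed
qed

end
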